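(* Let $\pi_h=\mathcal I\circ\mathcal R$ and $\tilde\pi_h=\tilde{\mathcal I}\circ\tilde{\mathcal R}$ be the projections associated with a cell complex $D$ and with its dual cell complex $\tilde D$ on $\Omega$. Then both projections commute with the exterior derivative: for $0\le k\le n-1$, $$\mathrm d\,\pi_h=\pi_h\,\mathrm d\qquad\text{and}\qquad \mathrm d\,\tilde\pi_h=\tilde\pi_h\,\mathrm d\qquad\text{on }\Lambda^k(\Omega).$$
   Context: $\Omega$ is an $n$-dimensional oriented Riemannian manifold (the computational domain) and $\Lambda^k(\Omega)$ is the space of differential $k$-forms on $\Omega$; $\mathrm d$ is the exterior derivative. $D$ is a finite oriented cell complex covering $\Omega$ (its $k$-cells are non-degenerate singular cubes $\tau_{(k)}:[-1,1]^k\to\Omega$), and $\tilde D$ is its dual cell complex, in which each $k$-cell of $D$ corresponds to a dual $(n-k)$-cell. The projection $\pi_h$ is built on the interior part $D_i$ of $D$ (that is, $D$ without the separately treated boundary cells) and $\tilde\pi_h$ on the interior part $\tilde D_i$ of $\tilde D$ (the collection of dual cells of the cells of $D_i$). $C_k$ denotes the space of $k$-chains (formal sums of $k$-cells) with boundary operator $\partial$. $C^k$ is the dual space of $k$-cochains (homomorphisms $C_k\to\mathbb R$), with pairing $\langle\cdot,\cdot\rangle$. The coboundary operator $\delta:C^k\to C^{k+1}$ is the formal adjoint of $\partial$: $\langle\delta c,b\rangle=\langle c,\partial b\rangle$. Reduction: $\mathcal R:\Lambda^k(\Omega)\to C^k$ is the linear map $\langle\mathcal R a^{(k)},c_{(k)}\rangle=\int_{c_{(k)}}a^{(k)}$.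 By Stokes' theorem it satisfies $\mathcal R\,\mathrm d=\delta\,\mathcal R$. Reconstruction: $\mathcal I:C^k\to\Lambda^k(\Omega)$ is a linear map, given for each $k$, satisfying $\mathcal R\,\mathcal I=\mathrm{Id}$ on $C^k$ and $\mathrm d\,\mathcal I=\mathcal I\,\delta$ on $C^k$. The operators $\tilde{\mathcal R},\tilde{\mathcal I}$ are the corresponding maps for the dual complex and satisfy the same relations. $\pi_h:=\mathcal I\circ\mathcal R$ and $\tilde\pi_h:=\tilde{\mathcal I}\circ\tilde{\mathcal R}$.
   Formalization: The interior part of each complex on which its projection is built is assumed closed under the boundary operator (the boundary of a chain of its cells is again such a chain); otherwise the coboundary is undefined there, or Stokes' relation and the claim fail. *)

theory Defs
  imports "HOL-Analysis.Analysis" "HOL-Library.Poly_Mapping"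
begin

section \<open>Oriented Riemannian manifolds\<close>

text \<open>A chart is a pair of its domain and its coordinate map. The manifold dimension is the
  cardinality of the index type \<open>'n\<close>.\<close>

type_synonym ('a, 'n) chart = "'a set \<times> ('a \<Rightarrow> real ^ 'n)"

record ('a, 'n) manifold =
  mtop :: "'a topology"
  atlas :: "('a, 'n) chart set"
  metric :: "('a, 'n) chart \<Rightarrow> real ^ 'n \<Rightarrow> real ^ 'n \<Rightarrow> real ^ 'n \<Rightarrow> real"

abbreviation codom :: "('a, 'n::finite) chart \<Rightarrow> (real ^ 'n) set" where
  "codom c \<equiv> snd c ` fst c"

text \<open>Coordinate images may be only relatively open in a coordinate cone (see \<open>chart_on\<close>), so
  derivatives are taken within the set.\<close>

primrec Cr_on :: "nat \<Rightarrow> (real ^ 'n::finite) set \<Rightarrow> (real ^ 'n \<Rightarrow> 'b::real_normed_vector) \<Rightarrow> bool" where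
  "Cr_on 0 S f \<longleftrightarrow> continuous_on S f"
| "Cr_on (Suc r) S f \<longleftrightarrow> continuous_on S f \<and> f differentiable_on S \<and>
     (\<forall>v. Cr_on r S (\<lambda>x. frechet_derivative f (at x within S) v))"

definition smooth_on :: "(real ^ 'n::finite) set \<Rightarrow> (real ^ 'n \<Rightarrow> 'b::real_normed_vector) \<Rightarrow> bool" where
  "smooth_on S f \<longleftrightarrow> (\<forall>r. Cr_on r S f)"

text \<open>The model space \<open>{x. \<forall>b\<in>B. 0 \<le> b \<bullet> x}\<close> with \<open>B\<close> linearly independent is the whole space for
  \<open>B = {}\<close>, a half-space for \<open>B = {b}\<close> (boundary points), and a corner for larger \<open>B\<close>.\<close>

definition chart_on :: "'a topology \<Rightarrow> ('a, 'n::finite) chart \<Rightarrow> bool" where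
  "chart_on X c \<longleftrightarrow> openin X (fst c) \<and>
     homeomorphic_map (subtopology X (fst c)) (top_of_set (codom c)) (snd c) \<and>
     (\<exists>B. independent B \<and> openin (top_of_set {x. \<forall>b\<in>B. 0 \<le> b \<bullet> x}) (codom c))"

definition overlap :: "('a, 'n::finite) chart \<Rightarrow> ('a, 'n) chart \<Rightarrow> (real ^ 'n) set" where
  "overlap c c' = snd c ` (fst c \<inter> fst c')"

definition transition :: "('a, 'n::finite) chart \<Rightarrow> ('a, 'n) chart \<Rightarrow> real ^ 'n \<Rightarrow> real ^ 'n" where
  "transition c c' x = snd c' (inv_into (fst c) (snd c) x)"

definition transition_deriv ::
  "('a, 'n::finite) chart \<Rightarrow> ('a, 'n) chart \<Rightarrow> real ^ 'n \<Rightarrow> real ^ 'n \<Rightarrow> real ^ 'n" where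
  "transition_deriv c c' x = frechet_derivative (transition c c') (at x within overlap c c')"

definition oriented_manifold :: "('a, 'n::finite) manifold \<Rightarrow> bool" where
  "oriented_manifold M \<longleftrightarrow>
     Hausdorff_space (mtop M) \<and> second_countable (mtop M) \<and>
     (\<forall>c\<in>atlas M. chart_on (mtop M) c) \<and>
     (\<Union>c\<in>atlas M. fst c) = topspace (mtop M) \<and>
     (\<forall>c\<in>atlas M. \<forall>c'\<in>atlas M.
        smooth_on (overlap c c') (transition c c') \<and>
        (\<forall>x\<in>overlap c c'. 0 < det (matrix (transition_deriv c c' x))))"

definition riemannian_metric :: "('a, 'n::finite) manifold \<Rightarrow> bool" where
  "riemannian_metric M \<longleftrightarrow>
     (\<forall>c\<in>atlas M.
        (\<forall>x\<in>codom c. bilinear (metric M c x) \<and>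
           (\<forall>u v. metric M c x u v = metric M c x v u) \<and>
           (\<forall>u. u \<noteq> 0 \<longrightarrow> 0 < metric M c x u u)) \<and>
        (\<forall>u v. smooth_on (codom c) (\<lambda>x. metric M c x u v))) \<and>
     (\<forall>c\<in>atlas M. \<forall>c'\<in>atlas M. \<forall>x\<in>overlap c c'. \<forall>u v.
        metric M c x u v =
        metric M c' (transition c c' x) (transition_deriv c c' x u) (transition_deriv c c' x v))"

definition oriented_riemannian_manifold :: "('a, 'n::finite) manifold \<Rightarrow> bool" where
  "oriented_riemannian_manifold M \<longleftrightarrow> oriented_manifold M \<and> riemannian_metric M"


section \<open>Differential forms\<close>

text \<open>The arguments of an alternating \<open>k\<close>-form are the first \<open>k\<close> entries of a sequence of vectors.\<close>

definition alternating_form :: "nat \<Rightarrow> ((nat \<Rightarrow> real ^ 'n::finite) \<Rightarrow> real) \<Rightarrow> bool" where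
  "alternating_form k f \<longleftrightarrow>
     (\<forall>v w. (\<forall>i<k. v i = w i) \<longrightarrow> f v = f w) \<and>
     (\<forall>i<k. \<forall>v. linear (\<lambda>u. f (v(i := u)))) \<and>
     (\<forall>i<k. \<forall>j<k. \<forall>v. i \<noteq> j \<and> v i = v j \<longrightarrow> f v = 0)"

text \<open>A differential form is the family of its coordinate representatives, one for each chart,
  which transform into each other by pullback. Representatives are zero outside the coordinate
  image, so that equality of forms is equality of functions.\<close>

type_synonym ('a, 'n) form =
  "('a, 'n) chart \<Rightarrow> real ^ 'n \<Rightarrow> (nat \<Rightarrow> real ^ 'n) \<Rightarrow> real"

definition forms :: "('a, 'n::finite) manifold \<Rightarrow> nat \<Rightarrow> ('a, 'n) form set" where
  "forms M k = {a.
     (\<forall>c x. c \<notin> atlas M \<or> x \<notin> codom c \<longrightarrow> a c x = (\<lambda>_. 0)) \<and>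
     (\<forall>c\<in>atlas M. (\<forall>x\<in>codom c. alternating_form k (a c x)) \<and>
                  (\<forall>v. smooth_on (codom c) (\<lambda>x. a c x v))) \<and>
     (\<forall>c\<in>atlas M. \<forall>c'\<in>atlas M. \<forall>x\<in>overlap c c'. \<forall>v.
        a c x v = a c' (transition c c' x) (\<lambda>i. transition_deriv c c' x (v i)))}"

definition omit :: "nat \<Rightarrow> (nat \<Rightarrow> 'b) \<Rightarrow> nat \<Rightarrow> 'b" where
  "omit i v = (\<lambda>j. if j < i then v j else v (Suc j))"

text \<open>The exterior derivative of a \<open>k\<close>-form, evaluated on coordinate-constant vector fields (for
  which all Lie brackets vanish).\<close>

definition ext_deriv :: "('a, 'n::finite) manifold \<Rightarrow> nat \<Rightarrow> ('a, 'n) form \<Rightarrow> ('a, 'n) form" where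
  "ext_deriv M k a = (\<lambda>c x v.
     if c \<in> atlas M \<and> x \<in> codom c
     then \<Sum>i\<le>k. (-1) ^ i * frechet_derivative (\<lambda>y. a c y (omit i v)) (at x within codom c) (v i)
     else 0)"


section \<open>Singular cubes and integration\<close>

definition cube :: "nat \<Rightarrow> (nat \<Rightarrow> real) set" where
  "cube k = {..<k} \<rightarrow>\<^sub>E {-1..1}"

definition partial :: "nat \<Rightarrow> ((nat \<Rightarrow> real) \<Rightarrow> 'b::real_normed_vector) \<Rightarrow> (nat \<Rightarrow> real) \<Rightarrow> 'b" where
  "partial i f t = vector_derivative (\<lambda>s. f (t(i := s))) (at (t i) within {-1..1})"

text \<open>Here \<open>U\<close> is a relatively open subset of \<open>cube k\<close>; partial derivatives are one-sided on the
  boundary of the cube.\<close>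

primrec cube_Cr :: "nat \<Rightarrow> nat \<Rightarrow> (nat \<Rightarrow> real) set \<Rightarrow> ((nat \<Rightarrow> real) \<Rightarrow> 'b::real_normed_vector) \<Rightarrow> bool" where
  "cube_Cr 0 k U f \<longleftrightarrow> continuous_on U f"
| "cube_Cr (Suc r) k U f \<longleftrightarrow> continuous_on U f \<and>
     (\<forall>i<k. (\<forall>t\<in>U. (\<lambda>s. f (t(i := s))) differentiable (at (t i) within {-1..1})) \<and>
            cube_Cr r k U (partial i f))"

definition cube_smooth :: "nat \<Rightarrow> (nat \<Rightarrow> real) set \<Rightarrow> ((nat \<Rightarrow> real) \<Rightarrow> 'b::real_normed_vector) \<Rightarrow> bool" where
  "cube_smooth k U f \<longleftrightarrow> (\<forall>r. cube_Cr r k U f)"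

definition singular_cube :: "('a, 'n::finite) manifold \<Rightarrow> nat \<Rightarrow> ((nat \<Rightarrow> real) \<Rightarrow> 'a) \<Rightarrow> bool" where
  "singular_cube M k \<tau> \<longleftrightarrow> \<tau> \<in> extensional (cube k) \<and>
     continuous_map (top_of_set (cube k)) (mtop M) \<tau> \<and>
     (\<forall>c\<in>atlas M. cube_smooth k {t \<in> cube k. \<tau> t \<in> fst c} (\<lambda>t. snd c (\<tau> t)))"

text \<open>A cube is degenerate if it does not depend on one of its coordinates.\<close>

definition nondegenerate :: "nat \<Rightarrow> ((nat \<Rightarrow> real) \<Rightarrow> 'a) \<Rightarrow> bool" where
  "nondegenerate k \<tau> \<longleftrightarrow> (\<forall>i<k. \<exists>t\<in>cube k. \<exists>s\<in>{-1..1}. \<tau> (t(i := s)) \<noteq> \<tau> t)"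

text \<open>The pullback of a \<open>k\<close>-form along a singular \<open>k\<close>-cube, evaluated on the coordinate frame. For
  a form it does not depend on the choice of the chart around the image point.\<close>

definition cube_pullback ::
  "('a, 'n::finite) manifold \<Rightarrow> ('a, 'n) form \<Rightarrow> ((nat \<Rightarrow> real) \<Rightarrow> 'a) \<Rightarrow> (nat \<Rightarrow> real) \<Rightarrow> real" where
  "cube_pullback M a \<tau> t =
     (let c = (SOME c. c \<in> atlas M \<and> \<tau> t \<in> fst c)
      in a c (snd c (\<tau> t)) (\<lambda>i. partial i (\<lambda>t. snd c (\<tau> t)) t))"

text \<open>A cell records its dimension together with its singular cube.\<close>

type_synonym 'a cell = "nat \<times> ((nat \<Rightarrow> real) \<Rightarrow> 'a)"

definition cell_integral :: "('a, 'n::finite) manifold \<Rightarrow> ('a, 'n) form \<Rightarrow> 'a cell \<Rightarrow> real" where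
  "cell_integral M a \<sigma> =
     (LINT t:cube (fst \<sigma>)|PiM {..<fst \<sigma>} (\<lambda>_. lborel). cube_pullback M a (snd \<sigma>) t)"


section \<open>Cell complexes\<close>

definition cube_face :: "nat \<Rightarrow> nat \<Rightarrow> real \<Rightarrow> ((nat \<Rightarrow> real) \<Rightarrow> 'a) \<Rightarrow> (nat \<Rightarrow> real) \<Rightarrow> 'a" where
  "cube_face k i \<alpha> \<tau> =
     restrict (\<lambda>t. \<tau> (\<lambda>j. if j < i then t j else if j = i then \<alpha> else t (j - 1))) (cube (k - 1))"

definition jacobian :: "nat \<Rightarrow> ((nat \<Rightarrow> real) \<Rightarrow> nat \<Rightarrow> real) \<Rightarrow> (nat \<Rightarrow> real) \<Rightarrow> real" where
  "jacobian k \<theta> t =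
     (\<Sum>p | p permutes {..<k}. of_int (sign p) * (\<Prod>i<k. partial (p i) (\<lambda>t. \<theta> t i) t))"

text \<open>\<open>reparam k s \<tau> \<sigma>\<close>: the \<open>k\<close>-cubes \<open>\<tau>\<close> and \<open>\<sigma>\<close> differ by a diffeomorphism of the standard cube
  that preserves (\<open>s = 1\<close>) or reverses (\<open>s = -1\<close>) its orientation, that is, they parametrize the
  same cell up to the orientation \<open>s\<close>.\<close>

definition reparam :: "nat \<Rightarrow> int \<Rightarrow> ((nat \<Rightarrow> real) \<Rightarrow> 'a) \<Rightarrow> ((nat \<Rightarrow> real) \<Rightarrow> 'a) \<Rightarrow> bool" where
  "reparam k s \<tau> \<sigma> \<longleftrightarrow> s \<in> {1, -1} \<and>
     (\<exists>\<theta> \<theta>'. \<theta> \<in> cube k \<rightarrow> cube k \<and> \<theta>' \<in> cube k \<rightarrow> cube k \<and>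
        (\<forall>t\<in>cube k. \<theta>' (\<theta> t) = t \<and> \<theta> (\<theta>' t) = t) \<and>
        (\<forall>i<k. cube_smooth k (cube k) (\<lambda>t. \<theta> t i) \<and> cube_smooth k (cube k) (\<lambda>t. \<theta>' t i)) \<and>
        (\<forall>t\<in>cube k. sgn (jacobian k \<theta> t) = of_int s) \<and>
        (\<forall>t\<in>cube k. \<tau> t = \<sigma> (\<theta> t)))"

text \<open>The faces of a cell are again cells of the complex, up to a reparametrization that matches or
  reverses the orientation.\<close>

definition cell_complex :: "('a, 'n::finite) manifold \<Rightarrow> 'a cell set \<Rightarrow> bool" where
  "cell_complex M D \<longleftrightarrow> finite D \<and>
     (\<forall>(k, \<tau>)\<in>D. k \<le> CARD('n) \<and> singular_cube M k \<tau> \<and> nondegenerate k \<tau> \<and>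
        (\<forall>i<k. \<forall>\<alpha>\<in>{-1, 1}. \<exists>!(\<sigma>, s). (k - 1, \<sigma>) \<in> D \<and> reparam (k - 1) s (cube_face k i \<alpha> \<tau>) \<sigma>)) \<and>
     (\<Union>(k, \<tau>)\<in>D. \<tau> ` cube k) = topspace (mtop M)"

definition is_facet :: "'a cell \<Rightarrow> 'a cell \<Rightarrow> bool" where
  "is_facet \<sigma> \<rho> \<longleftrightarrow> fst \<rho> = Suc (fst \<sigma>) \<and>
     (\<exists>i<fst \<rho>. \<exists>\<alpha>\<in>{-1, 1}. \<exists>s. reparam (fst \<sigma>) s (cube_face (fst \<rho>) i \<alpha> (snd \<rho>)) (snd \<sigma>))"

text \<open>Taking dual cells complements dimensions and reverses incidence. The dual complex may have
  further cells, namely those that close it up at the boundary of the manifold.\<close>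

definition dual_complex ::
  "('a, 'n::finite) manifold \<Rightarrow> 'a cell set \<Rightarrow> 'a cell set \<Rightarrow> ('a cell \<Rightarrow> 'a cell) \<Rightarrow> bool" where
  "dual_complex M D D' dual \<longleftrightarrow> cell_complex M D' \<and> inj_on dual D \<and> dual ` D \<subseteq> D' \<and>
     (\<forall>\<sigma>\<in>D. fst (dual \<sigma>) = CARD('n) - fst \<sigma>) \<and>
     (\<forall>\<sigma>\<in>D. \<forall>\<rho>\<in>D. is_facet \<sigma> \<rho> \<longleftrightarrow> is_facet (dual \<rho>) (dual \<sigma>))"


section \<open>Chains and cochains\<close>

type_synonym 'a chain = "'a cell \<Rightarrow>\<^sub>0 int"

definition chains :: "'a cell set \<Rightarrow> nat \<Rightarrow> 'a chain set" where
  "chains D k = {c. Poly_Mapping.keys c \<subseteq> {\<sigma> \<in> D. fst \<sigma> = k}}"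

text \<open>The face of a cell, expressed through the oriented cell of \<open>D\<close> that it parametrizes.\<close>

definition face_chain :: "'a cell set \<Rightarrow> nat \<Rightarrow> nat \<Rightarrow> real \<Rightarrow> ((nat \<Rightarrow> real) \<Rightarrow> 'a) \<Rightarrow> 'a chain" where
  "face_chain D k i \<alpha> \<tau> =
     (let (\<sigma>, s) = (THE (\<sigma>, s). (k - 1, \<sigma>) \<in> D \<and> reparam (k - 1) s (cube_face k i \<alpha> \<tau>) \<sigma>)
      in frag_cmul s (frag_of (k - 1, \<sigma>)))"

definition chain_bd :: "'a cell set \<Rightarrow> 'a chain \<Rightarrow> 'a chain" where
  "chain_bd D = frag_extend (\<lambda>(k, \<tau>).
     \<Sum>i<k. frag_cmul ((-1) ^ i) (face_chain D k i 1 \<tau> - face_chain D k i (-1) \<tau>))"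

text \<open>The boundary operator of \<open>D\<close> restricts to the chains of a part \<open>E\<close> of \<open>D\<close>.\<close>

definition bd_closed :: "'a cell set \<Rightarrow> 'a cell set \<Rightarrow> bool" where
  "bd_closed D E \<longleftrightarrow> (\<forall>k. chain_bd D ` chains E (Suc k) \<subseteq> chains E k)"

text \<open>Cochains are zero outside the chain group, so that equality of cochains is equality of
  functions.\<close>

definition cochains :: "'a cell set \<Rightarrow> nat \<Rightarrow> ('a chain \<Rightarrow> real) set" where
  "cochains E k = {f.
     (\<forall>b\<in>chains E k. \<forall>c\<in>chains E k. f (b + c) = f b + f c) \<and> (\<forall>c. c \<notin> chains E k \<longrightarrow> f c = 0)}"

definition coboundary ::
  "'a cell set \<Rightarrow> 'a cell set \<Rightarrow> nat \<Rightarrow> ('a chain \<Rightarrow> real) \<Rightarrow> 'a chain \<Rightarrow> real" where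
  "coboundary D E k f = (\<lambda>b. if b \<in> chains E (Suc k) then f (chain_bd D b) else 0)"

definition reduction ::
  "('a, 'n::finite) manifold \<Rightarrow> 'a cell set \<Rightarrow> nat \<Rightarrow> ('a, 'n) form \<Rightarrow> 'a chain \<Rightarrow> real" where
  "reduction M E k a = (\<lambda>c. if c \<in> chains E k
     then \<Sum>\<sigma>\<in>Poly_Mapping.keys c. of_int (Poly_Mapping.lookup c \<sigma>) * cell_integral M a \<sigma> else 0)"

definition reconstruction ::
  "('a, 'n::finite) manifold \<Rightarrow> 'a cell set \<Rightarrow> 'a cell set
     \<Rightarrow> (nat \<Rightarrow> ('a chain \<Rightarrow> real) \<Rightarrow> ('a, 'n) form) \<Rightarrow> bool" where
  "reconstruction M D E I \<longleftrightarrow>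
     (\<forall>k\<le>CARD('n). \<forall>f\<in>cochains E k.
        I k f \<in> forms M k \<and> reduction M E k (I k f) = f \<and>
        (\<forall>g\<in>cochains E k. \<forall>r s.
           I k (\<lambda>b. r * f b + s * g b) = (\<lambda>c x v. r * I k f c x v + s * I k g c x v))) \<and>
     (\<forall>k<CARD('n). \<forall>f\<in>cochains E k. ext_deriv M k (I k f) = I (Suc k) (coboundary D E k f))"

definition projection ::
  "('a, 'n::finite) manifold \<Rightarrow> 'a cell set \<Rightarrow> (nat \<Rightarrow> ('a chain \<Rightarrow> real) \<Rightarrow> ('a, 'n) form)
     \<Rightarrow> nat \<Rightarrow> ('a, 'n) form \<Rightarrow> ('a, 'n) form" where
  "projection M E I k = I k \<circ> reduction M E k"

end

(* Since d I = I delta, the claim reduces to R d = delta R, that is, to Stokes' theorem for every cell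
   together with the invariance of cell integrals under the reparametrizations that identify the
   faces of a cell with cells of the complex.

   Stokes: on the cube the coefficients of the pullback of a form are independent of the chart used to
   compute them, so no partition of unity is needed. In any chart the alternating sum of their partial
   derivatives is the pullback of the exterior derivative, because the second derivatives of the cube
   are symmetric. Fubini and the fundamental theorem of calculus in each coordinate give the claim.

   Reparametrization: the pullback of a k-form is multiplied by the Jacobian, and the change of
   variables theorem applies after padding the k-cube with further coordinates. *)
theory Submission
  imports Defs
begin

subsection \<open>Calculus on the cube\<close>

text \<open>Three mismatches shape the development. Points of a cube are extensional functions on
  the naturals with a varying dimension \<open>k\<close>, whereas total derivatives, Borel
  measurability and change of variables live on \<open>real ^ 'm\<close>, whose dimension is fixed
  by a type. Functions on the cube are therefore moved along \<open>cube_point\<close> to a box of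
  any dimension at least \<open>k\<close>, where they are constant in the surplus coordinates.
  Second, coordinate images may be only relatively open in a cone, and derivatives on the cube are
  one-sided at its boundary. Forms are hence differentiated only along coordinate lines of the cube,
  where a derivative within an interval is unique. Third, \<open>forms\<close> prescribes smoothness
  for fixed argument vectors, whereas the velocities of a cube vary with the point; expansion in
  basis vectors bridges the gap. As for orientation, the sign \<open>s\<close> by which a face
  differs from a cell of the complex enters the boundary chain and the transformed integral
  alike.\<close>

lemma cube_update: "t \<in> cube k \<Longrightarrow> i < k \<Longrightarrow> s \<in> {-1..1} \<Longrightarrow> t(i := s) \<in> cube k"
  by (auto simp: cube_def PiE_iff extensional_def)

lemma cube_bounds: "t \<in> cube k \<Longrightarrow> i < k \<Longrightarrow> t i \<in> {-1..1}"
  by (simp add: cube_def PiE_iff)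

text \<open>A basic open set of the product topology bounds each coordinate separately. From index
  \<open>k\<close> on all points of \<open>cube k\<close> agree, being \<open>undefined\<close>
  there, so only \<open>k\<close> radii matter and their minimum is positive. The result is a
  neighbourhood in the maximum norm.\<close>

lemma cube_neighbourhood:
  assumes "openin (top_of_set (cube k)) U" "t \<in> U"
  obtains d where "d > 0" "\<And>y. y \<in> cube k \<Longrightarrow> (\<And>i. i < k \<Longrightarrow> \<bar>y i - t i\<bar> < d) \<Longrightarrow> y \<in> U"
proof -
  obtain W where W: "open W" "U = cube k \<inter> W"
    using assms by (auto simp: openin_open)
  then have "openin (product_topology (\<lambda>i. euclidean) UNIV) W"
    by (simp add: open_fun_def)
  from product_topology_open_contains_basis[OF this, of t] obtain X where
    X: "t \<in> (\<Pi>\<^sub>E i\<in>UNIV. X i)" "\<And>i. open (X i)" "(\<Pi>\<^sub>E i\<in>UNIV. X i) \<subseteq> W"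
    using assms W by auto
  have "\<exists>e>0. ball (t i) e \<subseteq> X i" for i
    using X(1,2) by (meson PiE_mem UNIV_I openE)
  then obtain e where e: "\<And>i. e i > 0" "\<And>i. ball (t i) (e i) \<subseteq> X i"
    by metis
  \<comment> \<open>The element 1 keeps the set nonempty when \<open>k = 0\<close>.\<close>
  define d where "d = Min (insert 1 (e ` {..<k}))"
  have "d > 0" using e(1) by (auto simp: d_def)
  moreover have "y \<in> U" if y: "y \<in> cube k" "\<And>i. i < k \<Longrightarrow> \<bar>y i - t i\<bar> < d" for y
  proof -
    have "y i \<in> X i" for i
    proof (cases "i < k")
      case True
      then have "d \<le> e i" by (auto simp: d_def)
      then have "y i \<in> ball (t i) (e i)"
        using y(2)[OF True] by (auto simp: dist_real_def abs_minus_commute)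
      then show ?thesis using e(2) by blast
    next
      case False
      then have "y i = t i"
        using y(1) assms W by (auto simp: cube_def PiE_iff extensional_def)
      then show ?thesis using X(1) by auto
    qed
    then show ?thesis using X(3) y(1) W by auto
  qed
  ultimately show ?thesis using that by blast
qed

lemma cube_CrD:
  assumes "cube_Cr (Suc r) k U f"
  shows "continuous_on U f" "i < k \<Longrightarrow> cube_Cr r k U (partial i f)"
    "i < k \<Longrightarrow> continuous_on U (partial i f)"
    "i < k \<Longrightarrow> t \<in> U \<Longrightarrow>
      ((\<lambda>s. f (t(i := s))) has_vector_derivative partial i f t) (at (t i) within {-1..1})"
proof -
  show "continuous_on U f" "i < k \<Longrightarrow> cube_Cr r k U (partial i f)"
    using assms by auto
  then show "continuous_on U (partial i f)" if "i < k"
    using that by (cases r) auto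
  show "((\<lambda>s. f (t(i := s))) has_vector_derivative partial i f t) (at (t i) within {-1..1})"
    if "i < k" "t \<in> U"
  proof -
    have "(\<lambda>s. f (t(i := s))) differentiable (at (t i) within {-1..1})"
      using assms that by auto
    then show ?thesis
      unfolding partial_def by (rule vector_derivative_works[THEN iffD1])
  qed
qed

lemma at_within_interval_neq_bot: "t \<in> {-1..1::real} \<Longrightarrow> at t within {-1..1} \<noteq> bot"
  by (simp add: trivial_limit_within)

lemma partial_eqI:
  assumes "t i \<in> {-1..1}"
    and "((\<lambda>s. f (t(i := s))) has_vector_derivative D) (at (t i) within {-1..1})"
  shows "partial i f t = D"
  unfolding partial_def
  by (rule vector_derivative_within[OF at_within_interval_neq_bot]) (use assms in auto)

section \<open>Cube points as coordinates of vectors\<close>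

definition cart_index :: "'m::finite \<Rightarrow> nat" where
  "cart_index = (SOME f. bij_betw f UNIV {..<CARD('m)})"

text \<open>Inverse of an arbitrary enumeration of \<open>'m\<close>. Only indices below
  \<open>CARD('m)\<close> are translated back correctly, whence the bound
  \<open>k \<le> CARD('m)\<close> in the statements about padding.\<close>

definition crd :: "nat \<Rightarrow> 'm::finite" where
  "crd = inv cart_index"

lemma bij_cart_index: "bij_betw (cart_index :: 'm::finite \<Rightarrow> nat) UNIV {..<CARD('m)}"
  unfolding cart_index_def
  by (rule someI_ex[of "\<lambda>f. bij_betw f UNIV {..<CARD('m)}"], rule finite_same_card_bij) simp_all

lemma crd_index [simp]: "crd (cart_index m) = (m :: 'm::finite)"
  using bij_cart_index[where 'm='m] by (simp add: crd_def bij_betw_def)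

lemma index_crd: "i < CARD('m) \<Longrightarrow> cart_index (crd i :: 'm::finite) = i"
  using bij_cart_index[where 'm='m] unfolding crd_def
  by (metis bij_betw_imp_surj_on f_inv_into_f lessThan_iff)

lemma cart_index_less: "cart_index (m :: 'm::finite) < CARD('m)"
  using bij_cart_index[where 'm='m] by (auto simp: bij_betw_def)

text \<open>Points of the cube \<open>cube k\<close> are read off the first \<open>k\<close> coordinates of a vector. The remaining
  coordinates only pad the dimension of \<open>real ^ 'm\<close>, which is a type and cannot be \<open>k\<close>.\<close>

definition cube_point :: "nat \<Rightarrow> real ^ 'm::finite \<Rightarrow> nat \<Rightarrow> real" where
  "cube_point k x = (\<lambda>i\<in>{..<k}. x $ crd i)"

definition pad :: "nat \<Rightarrow> (nat \<Rightarrow> real) \<Rightarrow> real ^ 'm::finite" where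
  "pad k t = (\<chi> m. if cart_index m < k then t (cart_index m) else 0)"

text \<open>The padding coordinates range over the whole interval as well, so that this is a
  full-dimensional compact box; the price is the power of 2 in
  \<open>integral_unit_box\<close>.\<close>

definition unit_box :: "(real ^ 'm::finite) set" where
  "unit_box = {x. \<forall>m. x $ m \<in> {-1..1}}"

lemma unit_box_cbox: "unit_box = cbox (\<chi> m. -1) (\<chi> m. 1)"
  by (auto simp: unit_box_def mem_box_cart)

lemma cube_point_cube: "x \<in> unit_box \<Longrightarrow> cube_point k x \<in> cube k"
  by (auto simp: unit_box_def cube_point_def cube_def PiE_iff)

lemma pad_unit_box: "t \<in> cube k \<Longrightarrow> pad k t \<in> unit_box"
  by (auto simp: unit_box_def pad_def cube_def PiE_iff)

lemma cube_point_pad: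
  "k \<le> CARD('m::finite) \<Longrightarrow> t \<in> extensional {..<k} \<Longrightarrow> cube_point k (pad k t :: real ^ 'm) = t"
  by (auto simp: cube_point_def pad_def index_crd extensional_def fun_eq_iff)

lemma continuous_on_cube_point: "continuous_on S (cube_point k)"
  unfolding cube_point_def restrict_def
proof (rule continuous_on_coordinatewise_then_product)
  show "continuous_on S (\<lambda>x. if i \<in> {..<k} then x $ crd i else undefined)" for i
    by (cases "i < k") (auto intro!: continuous_intros)
qed

lemma sum_crd_le_norm: "k \<le> CARD('m) \<Longrightarrow> (\<Sum>l<k. \<bar>h $ (crd l :: 'm::finite)\<bar>) \<le> k * norm h"
  using sum_mono[of "{..<k}" "\<lambda>l. \<bar>h $ (crd l :: 'm)\<bar>" "\<lambda>_. norm h"]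
  by (simp add: component_le_norm_cart)

text \<open>Continuous partial derivatives give a total derivative, also on the boundary: changing
  one coordinate at a time stays in the cube, because the cube is a product of intervals, and each
  change is controlled by the mean value inequality.\<close>

lemma cube_has_derivative:
  fixes f :: "(nat \<Rightarrow> real) \<Rightarrow> 'b::real_normed_vector" and x :: "real ^ 'm::finite"
  assumes k: "k \<le> CARD('m)" and U: "openin (top_of_set (cube k)) U" and f: "cube_Cr (Suc 0) k U f"
    and x: "x \<in> unit_box" "cube_point k x \<in> U"
  shows "((\<lambda>x. f (cube_point k x)) has_derivative
           (\<lambda>h. \<Sum>l<k. h $ crd l *\<^sub>R partial l f (cube_point k x))) (at x within unit_box)"
  unfolding has_derivative_within_alt
proof (intro conjI allI impI)
  show "bounded_linear (\<lambda>h. \<Sum>l<k. h $ crd l *\<^sub>R partial l f (cube_point k x))"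
    by (intro bounded_linear_sum bounded_linear_scaleR_const bounded_linear_vec_nth)
next
  fix e :: real assume "e > 0"
  define X where "X = cube_point k x"
  \<comment> \<open>Each of the \<open>k\<close> coordinate changes costs \<open>e'\<close> times a
    coordinate difference, which the norm bounds; \<open>k + 1\<close> instead of \<open>k\<close>
    avoids a division by zero.\<close>
  define e' where "e' = e / (k + 1)"
  have "e' > 0" using \<open>e > 0\<close> by (simp add: e'_def)
  have Uc: "U \<subseteq> cube k" using U by (auto dest: openin_imp_subset)
  define V where "V = {z\<in>U. \<forall>l<k. norm (partial l f z - partial l f X) < e'}"
  have "V = U \<inter> (\<Inter>l\<in>{..<k}. {z\<in>U. partial l f z \<in> ball (partial l f X) e'})"
    by (auto simp: V_def dist_norm norm_minus_commute)
  moreover have "openin (top_of_set (cube k)) {z\<in>U. partial l f z \<in> ball (partial l f X) e'}" if "l < k" for l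
  proof -
    have "openin (top_of_set U) (U \<inter> partial l f -` ball (partial l f X) e')"
      using cube_CrD(3)[OF f that] by (rule continuous_openin_preimage_gen) simp
    then show ?thesis
      using openin_trans[OF _ U] by (simp add: vimage_def Int_def)
  qed
  ultimately have "openin (top_of_set (cube k)) V"
    using U by (cases "k = 0") (auto intro!: openin_Int openin_INT2)
  moreover have "X \<in> V" using x \<open>e' > 0\<close> by (auto simp: V_def X_def)
  ultimately obtain d where d: "d > 0" "\<And>y. y \<in> cube k \<Longrightarrow> (\<And>i. i < k \<Longrightarrow> \<bar>y i - X i\<bar> < d) \<Longrightarrow> y \<in> V"
    by (rule cube_neighbourhood) blast
  have "norm (f (cube_point k y) - f X - (\<Sum>l<k. (y - x) $ crd l *\<^sub>R partial l f X)) \<le> e * norm (y - x)"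
    if y: "y \<in> unit_box" "norm (y - x) < d" for y
  proof -
    define Y where "Y = cube_point k y"
    have XY: "X \<in> cube k" "Y \<in> cube k" using x y by (auto simp: X_def Y_def cube_point_cube)
    \<comment> \<open>A path of corners from \<open>X\<close> at 0 to \<open>Y\<close> at
      \<open>k\<close>; step \<open>l\<close> changes coordinate \<open>l\<close> only.\<close>
    define z where "z l = (\<lambda>i. if i < l then Y i else X i)" for l
    have near: "\<bar>Y i - X i\<bar> < d" if "i < k" for i
      using y(2) component_le_norm_cart[of "y - x" "crd i"] that
      by (auto simp: X_def Y_def cube_point_def)
    have step: "norm (f (z (Suc l)) - f (z l) - (Y l - X l) *\<^sub>R partial l f X) \<le> e' * \<bar>Y l - X l\<bar>"
      if l: "l < k" for l
    proof -
      have zc: "z l \<in> cube k" using XY by (auto simp: z_def cube_def PiE_iff extensional_def Pi_def)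
      define S where "S = closed_segment (X l) (Y l)"
      have S: "S \<subseteq> {-1..1}" "\<And>s. s \<in> S \<Longrightarrow> \<bar>s - X l\<bar> < d"
        using cube_bounds[OF XY(1) l] cube_bounds[OF XY(2) l] near[OF l]
        by (auto simp: S_def closed_segment_eq_real_ivl split: if_splits)
      have zV: "(z l)(l := s) \<in> V" if "s \<in> S" for s
      proof (rule d(2))
        show "(z l)(l := s) \<in> cube k" using zc l S(1) that by (auto intro!: cube_update)
        show "\<bar>((z l)(l := s)) i - X i\<bar> < d" if "i < k" for i
          using near[OF that] S(2)[OF \<open>s \<in> S\<close>] d(1) by (auto simp: z_def)
      qed
      \<comment> \<open>With the linear part subtracted, the derivative of \<open>g\<close> is a
        difference of two values of a partial derivative, which is small on
        \<open>V\<close>.\<close>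
      define g where "g s = f ((z l)(l := s)) - s *\<^sub>R partial l f X" for s
      have "norm (g (Y l) - g (X l)) \<le> e' * norm (Y l - X l)"
      proof (rule differentiable_bound)
        show "convex S" by (simp add: S_def)
        fix s assume s: "s \<in> S"
        have "((\<lambda>s'. f (((z l)(l := s))(l := s'))) has_vector_derivative partial l f ((z l)(l := s)))
           (at (((z l)(l := s)) l) within {-1..1})"
          using zV[OF s] by (intro cube_CrD(4)[OF f l]) (auto simp: V_def)
        then have "((\<lambda>s'. f ((z l)(l := s'))) has_vector_derivative partial l f ((z l)(l := s)))
           (at s within S)"
          using S(1) by (auto intro: has_vector_derivative_within_subset)
        then have "(g has_vector_derivative (partial l f ((z l)(l := s)) - 1 *\<^sub>R partial l f X)) (at s within S)"
          unfolding g_def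
          by (intro derivative_intros)
             (auto simp: has_vector_derivative_def intro!: derivative_eq_intros)
        then show "(g has_derivative (\<lambda>h. h *\<^sub>R (partial l f ((z l)(l := s)) - partial l f X))) (at s within S)"
          by (simp add: has_vector_derivative_def)
        show "onorm (\<lambda>h. h *\<^sub>R (partial l f ((z l)(l := s)) - partial l f X)) \<le> e'"
          using zV[OF s] l \<open>e' > 0\<close> by (intro onorm_bound) (auto simp: V_def mult.commute[of e'] intro!: mult_left_mono)
      qed (auto simp: S_def)
      moreover have "z (Suc l) = (z l)(l := Y l)" "z l = (z l)(l := X l)"
        by (auto simp: z_def)
      then have "g (Y l) - g (X l) = f (z (Suc l)) - f (z l) - (Y l - X l) *\<^sub>R partial l f X"
        unfolding g_def by (simp add: algebra_simps)
      ultimately show ?thesis by simp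
    qed
    have z0: "z 0 = X" by (auto simp: z_def)
    have zk: "z k = Y" using XY by (auto simp: z_def cube_def PiE_iff extensional_def fun_eq_iff)
    have crd: "(y - x) $ crd l = Y l - X l" if "l < k" for l
      using that by (simp add: X_def Y_def cube_point_def)
    have "f Y - f X - (\<Sum>l<k. (y - x) $ crd l *\<^sub>R partial l f X)
        = (\<Sum>l<k. f (z (Suc l)) - f (z l) - (Y l - X l) *\<^sub>R partial l f X)"
      using sum_lessThan_telescope[of "\<lambda>l. f (z l)" k] crd by (simp add: sum_subtractf z0 zk)
    also have "norm \<dots> \<le> (\<Sum>l<k. e' * \<bar>Y l - X l\<bar>)"
      by (rule order_trans[OF norm_sum]) (auto intro!: sum_mono step)
    also have "\<dots> = e' * (\<Sum>l<k. \<bar>(y - x) $ crd l\<bar>)"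
      using crd by (simp add: sum_distrib_left)
    also have "\<dots> \<le> e' * (k * norm (y - x))"
      using \<open>e' > 0\<close> k by (intro mult_left_mono sum_crd_le_norm) auto
    also have "\<dots> \<le> e * norm (y - x)"
      using \<open>e > 0\<close> by (simp add: e'_def field_simps mult_right_mono)
    finally show ?thesis by (simp add: Y_def)
  qed
  then show "\<exists>d>0. \<forall>y\<in>unit_box. norm (y - x) < d \<longrightarrow>
      norm (f (cube_point k y) - f (cube_point k x) - (\<Sum>l<k. (y - x) $ crd l *\<^sub>R partial l f (cube_point k x))) \<le> e * norm (y - x)"
    using d(1) by (auto simp: X_def)
qed

section \<open>Symmetry of second partial derivatives\<close>

lemma mixed_difference:
  fixes g :: "real \<Rightarrow> real \<Rightarrow> real"
  assumes "a < b" "c < d"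
    and gx: "\<And>u v. u \<in> {a..b} \<Longrightarrow> v \<in> {c..d} \<Longrightarrow>
      ((\<lambda>u. g u v) has_vector_derivative gx u v) (at u within {a..b})"
    and gxy: "\<And>u v. u \<in> {a..b} \<Longrightarrow> v \<in> {c..d} \<Longrightarrow>
      ((\<lambda>v. gx u v) has_vector_derivative gxy u v) (at v within {c..d})"
  obtains u v where "u \<in> {a..b}" "v \<in> {c..d}"
    "g b d - g a d - g b c + g a c = gxy u v * ((b - a) * (d - c))"
proof -
  have "((\<lambda>u. g u d - g u c) has_derivative (\<lambda>h. h *\<^sub>R (gx u d - gx u c))) (at u within {a..b})"
    if "a \<le> u" "u \<le> b" for u
    using that \<open>c < d\<close> unfolding has_vector_derivative_def[symmetric]
    by (intro has_vector_derivative_diff gx) auto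
  then have "\<exists>u\<in>{a<..<b}. (g b d - g b c) - (g a d - g a c) = (b - a) *\<^sub>R (gx u d - gx u c)"
    by (rule mvt_simple[OF \<open>a < b\<close>])
  then obtain u where u: "u \<in> {a<..<b}" "(g b d - g b c) - (g a d - g a c) = (b - a) *\<^sub>R (gx u d - gx u c)"
    by blast
  have "\<exists>v\<in>{c<..<d}. gx u d - gx u c = (d - c) *\<^sub>R gxy u v"
    using u by (intro mvt_simple[OF \<open>c < d\<close>] gxy[unfolded has_vector_derivative_def]) auto
  then obtain v where v: "v \<in> {c<..<d}" "gx u d - gx u c = (d - c) *\<^sub>R gxy u v"
    by blast
  have "g b d - g a d - g b c + g a c = gxy u v * ((b - a) * (d - c))"
    using u(2) unfolding v(2) by (simp add: algebra_simps)
  then show ?thesis using that[of u v] u(1) v(1) by auto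
qed

text \<open>Schwarz's theorem, with one-sided derivatives at the boundary. By two applications of
  the mean value theorem the second difference over a small rectangle is its area times either mixed
  derivative at some point of the rectangle. If the two differed at \<open>t\<close>, continuity
  would keep their values on the rectangle apart.\<close>

lemma partial_commute:
  fixes f :: "(nat \<Rightarrow> real) \<Rightarrow> 'b::euclidean_space"
  assumes U: "openin (top_of_set (cube k)) U" and f: "cube_Cr (Suc (Suc 0)) k U f"
    and t: "t \<in> U" and i: "i < k" and j: "j < k"
  shows "partial i (partial j f) t = partial j (partial i f) t"
proof (cases "i = j")
  case False
  have U_cube: "U \<subseteq> cube k" using U by (auto dest: openin_imp_subset)
  have C1: "cube_Cr (Suc 0) k U f" using f by auto
  have Ci: "cube_Cr (Suc 0) k U (partial i f)" and Cj: "cube_Cr (Suc 0) k U (partial j f)"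
    using f i j by auto
  show ?thesis
  proof (rule euclidean_eqI, rule ccontr)
    fix b :: 'b assume b: "b \<in> Basis"
    define P where "P = (\<lambda>t. partial i (partial j f) t \<bullet> b)"
    define Q where "Q = (\<lambda>t. partial j (partial i f) t \<bullet> b)"
    assume ne: "partial i (partial j f) t \<bullet> b \<noteq> partial j (partial i f) t \<bullet> b"
    \<comment> \<open>Half the gap, so that the balls of radius \<open>e\<close> around
      \<open>P t\<close> and \<open>Q t\<close> are disjoint.\<close>
    define e where "e = \<bar>P t - Q t\<bar> / 2"
    have "e > 0" using ne by (simp add: e_def P_def Q_def)
    have cont: "continuous_on U P" "continuous_on U Q"
      unfolding P_def Q_def using cube_CrD(3)[OF Ci j] cube_CrD(3)[OF Cj i]
      by (auto intro!: continuous_intros)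
    have nbhd: "openin (top_of_set (cube k)) (U \<inter> R -` ball (R t) e)" if "continuous_on U R" for R :: "_ \<Rightarrow> real"
      using that U by (meson continuous_openin_preimage_gen open_ball openin_trans)
    have "openin (top_of_set (cube k)) ((U \<inter> P -` ball (P t) e) \<inter> (U \<inter> Q -` ball (Q t) e))"
      using cont by (intro openin_Int nbhd)
    moreover have "t \<in> (U \<inter> P -` ball (P t) e) \<inter> (U \<inter> Q -` ball (Q t) e)"
      using t \<open>e > 0\<close> by simp
    ultimately obtain d where d: "d > 0"
      "\<And>y. y \<in> cube k \<Longrightarrow> (\<And>i. i < k \<Longrightarrow> \<bar>y i - t i\<bar> < d) \<Longrightarrow>
        y \<in> (U \<inter> P -` ball (P t) e) \<inter> (U \<inter> Q -` ball (Q t) e)"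
      by (rule cube_neighbourhood) blast
    \<comment> \<open>The rectangle is clipped to the cube and stays nondegenerate when
      \<open>t l\<close> is an endpoint of the interval; \<open>d / 2\<close> makes the distances
      strictly less than \<open>d\<close>.\<close>
    define lo hi where "lo l = max (-1) (t l - d / 2)" and "hi l = min 1 (t l + d / 2)" for l
    have tc: "t \<in> cube k" using t U_cube by auto
    have lohi: "lo l < hi l" "{lo l..hi l} \<subseteq> {-1..1}" "\<And>s. s \<in> {lo l..hi l} \<Longrightarrow> \<bar>s - t l\<bar> < d" if "l < k" for l
      using cube_bounds[OF tc that] d(1) by (auto simp: lo_def hi_def)
    define y where "y u v = t(i := u, j := v)" for u v
    have y: "y u v \<in> cube k" "y u v \<in> U" "\<bar>P (y u v) - P t\<bar> < e" "\<bar>Q (y u v) - Q t\<bar> < e"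
      if "u \<in> {lo i..hi i}" "v \<in> {lo j..hi j}" for u v
    proof -
      show yc: "y u v \<in> cube k"
        using that lohi(2)[OF i] lohi(2)[OF j] i j tc unfolding y_def by (intro cube_update) auto
      have "\<bar>y u v l - t l\<bar> < d" if "l < k" for l
        using lohi(3)[OF i \<open>u \<in> _\<close>] lohi(3)[OF j \<open>v \<in> _\<close>] d(1) by (auto simp: y_def)
      from d(2)[OF yc this] show "y u v \<in> U" "\<bar>P (y u v) - P t\<bar> < e" "\<bar>Q (y u v) - Q t\<bar> < e"
        by (auto simp: dist_real_def abs_minus_commute)
    qed
    have deriv_i: "((\<lambda>u. h (y u v) \<bullet> b) has_vector_derivative partial i h (y u v) \<bullet> b) (at u within {lo i..hi i})"
      if h: "cube_Cr (Suc 0) k U h" and uv: "u \<in> {lo i..hi i}" "v \<in> {lo j..hi j}" for h :: "_ \<Rightarrow> 'b" and u v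
    proof -
      have "((\<lambda>s. h ((y u v)(i := s))) has_vector_derivative partial i h (y u v)) (at ((y u v) i) within {-1..1})"
        by (rule cube_CrD(4)[OF h i y(2)[OF uv]])
      then have "((\<lambda>s. h (y s v)) has_vector_derivative partial i h (y u v)) (at u within {-1..1})"
        using False by (simp add: y_def fun_upd_twist)
      then have "((\<lambda>s. h (y s v)) has_vector_derivative partial i h (y u v)) (at u within {lo i..hi i})"
        using lohi(2)[OF i] by (rule has_vector_derivative_within_subset)
      from bounded_linear.has_vector_derivative[OF bounded_linear_inner_left this]
      show ?thesis .
    qed
    have deriv_j: "((\<lambda>v. h (y u v) \<bullet> b) has_vector_derivative partial j h (y u v) \<bullet> b) (at v within {lo j..hi j})"
      if h: "cube_Cr (Suc 0) k U h" and uv: "u \<in> {lo i..hi i}" "v \<in> {lo j..hi j}" for h :: "_ \<Rightarrow> 'b" and u v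
    proof -
      have "((\<lambda>s. h ((y u v)(j := s))) has_vector_derivative partial j h (y u v)) (at ((y u v) j) within {-1..1})"
        by (rule cube_CrD(4)[OF h j y(2)[OF uv]])
      then have "((\<lambda>s. h (y u s)) has_vector_derivative partial j h (y u v)) (at v within {-1..1})"
        by (simp add: y_def)
      then have "((\<lambda>s. h (y u s)) has_vector_derivative partial j h (y u v)) (at v within {lo j..hi j})"
        using lohi(2)[OF j] by (rule has_vector_derivative_within_subset)
      from bounded_linear.has_vector_derivative[OF bounded_linear_inner_left this]
      show ?thesis .
    qed
    let ?g = "\<lambda>u v. f (y u v) \<bullet> b"
    obtain u v where uv: "u \<in> {lo i..hi i}" "v \<in> {lo j..hi j}"
      "?g (hi i) (hi j) - ?g (lo i) (hi j) - ?g (hi i) (lo j) + ?g (lo i) (lo j)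
        = Q (y u v) * ((hi i - lo i) * (hi j - lo j))"
    proof (rule mixed_difference[where g = ?g and gx = "\<lambda>u v. partial i f (y u v) \<bullet> b"
          and gxy = "\<lambda>u v. Q (y u v)", OF lohi(1)[OF i] lohi(1)[OF j]], goal_cases)
      case (1 u v) from 1(2,3) show ?case by (rule deriv_i[OF C1])
    next
      case (2 u v) from 2(2,3) show ?case unfolding Q_def by (rule deriv_j[OF Ci])
    qed blast
    \<comment> \<open>The same second difference, now differentiated in \<open>j\<close> first and
      in \<open>i\<close> afterwards.\<close>
    obtain v' u' where uv': "v' \<in> {lo j..hi j}" "u' \<in> {lo i..hi i}"
      "?g (hi i) (hi j) - ?g (hi i) (lo j) - ?g (lo i) (hi j) + ?g (lo i) (lo j)
        = P (y u' v') * ((hi j - lo j) * (hi i - lo i))"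
    proof (rule mixed_difference[where g = "\<lambda>v u. ?g u v" and gx = "\<lambda>v u. partial j f (y u v) \<bullet> b"
          and gxy = "\<lambda>v u. P (y u v)", OF lohi(1)[OF j] lohi(1)[OF i]], goal_cases)
      case (1 v u) from 1(3,2) show ?case by (rule deriv_j[OF C1])
    next
      case (2 v u) from 2(3,2) show ?case unfolding P_def by (rule deriv_i[OF Cj])
    qed blast
    have "Q (y u v) * ((hi i - lo i) * (hi j - lo j)) = P (y u' v') * ((hi i - lo i) * (hi j - lo j))"
      using uv(3) uv'(3) unfolding mult.commute[of "hi j - lo j"] by linarith
    then have "Q (y u v) = P (y u' v')"
      using lohi(1)[OF i] lohi(1)[OF j] by simp
    then show False
      using y(4)[OF uv(1,2)] y(3)[OF uv'(2,1)] \<open>e > 0\<close> by (auto simp: e_def abs_if split: if_splits)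
  qed
qed simp

lemma at_within_interval_neighbourhood:
  "d > 0 \<Longrightarrow> at x within {-1..1::real} \<inter> ball x d = at x within {-1..1}"
  by (rule at_within_nhd[of _ "ball x d"]) auto

text \<open>A coordinate line through \<open>t\<close> may leave the domain of a chart. Derivatives
  at \<open>t i\<close> see only nearby parameters, so it may be cut down to a piece inside
  \<open>U\<close>.\<close>

lemma cube_line_neighbourhood:
  assumes "openin (top_of_set (cube k)) U" "t \<in> U" "i < k"
  obtains d where "d > 0" "\<And>s. s \<in> {-1..1} \<inter> ball (t i) d \<Longrightarrow> t(i := s) \<in> U"
proof -
  obtain d where d: "d > 0" "\<And>y. y \<in> cube k \<Longrightarrow> (\<And>i. i < k \<Longrightarrow> \<bar>y i - t i\<bar> < d) \<Longrightarrow> y \<in> U"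
    using cube_neighbourhood[OF assms(1,2)] by blast
  have tc: "t \<in> cube k" using assms by (auto dest: openin_imp_subset)
  have "t(i := s) \<in> U" if "s \<in> {-1..1} \<inter> ball (t i) d" for s
    using that d(1) by (intro d(2) cube_update[OF tc assms(3)]) (auto simp: dist_real_def abs_minus_commute)
  with d(1) that show ?thesis by blast
qed

text \<open>The chain rule, obtained by lifting the curve to \<open>unit_box\<close> with zeros in
  the padding coordinates, where the total derivative of \<open>cube_has_derivative\<close> is
  available.\<close>

lemma has_vector_derivative_cube_compose:
  fixes f :: "(nat \<Rightarrow> real) \<Rightarrow> 'b::real_normed_vector" and \<gamma> :: "real \<Rightarrow> nat \<Rightarrow> real"
  assumes k: "k \<le> CARD('m::finite)" and U: "openin (top_of_set (cube k)) U"
    and f: "cube_Cr (Suc 0) k U f"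
    and \<gamma>: "\<And>s. s \<in> S \<Longrightarrow> \<gamma> s \<in> cube k" "s0 \<in> S" "\<gamma> s0 \<in> U"
    and \<gamma>': "\<And>l. l < k \<Longrightarrow> ((\<lambda>s. \<gamma> s l) has_vector_derivative \<gamma>' l) (at s0 within S)"
  shows "((\<lambda>s. f (\<gamma> s)) has_vector_derivative (\<Sum>l<k. \<gamma>' l *\<^sub>R partial l f (\<gamma> s0))) (at s0 within S)"
proof -
  define p :: "real \<Rightarrow> real ^ 'm" where "p s = pad k (\<gamma> s)" for s
  have cp: "cube_point k (p s) = \<gamma> s" if "s \<in> S" for s
    using \<gamma>(1)[OF that] k unfolding p_def
    by (intro cube_point_pad) (auto simp: cube_def PiE_iff)
  have p: "(p has_vector_derivative pad k \<gamma>') (at s0 within S)"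
    unfolding has_vector_derivative_def
  proof (subst has_derivative_componentwise_within, rule ballI)
    fix b :: "real ^ 'm" assume "b \<in> Basis"
    then obtain m where b: "b = axis m 1" by (auto simp: Basis_vec_def)
    show "((\<lambda>s. p s \<bullet> b) has_derivative (\<lambda>x. x *\<^sub>R pad k \<gamma>' \<bullet> b)) (at s0 within S)"
      using \<gamma>'[of "cart_index m"]
      by (cases "cart_index m < k") (auto simp: b inner_axis p_def pad_def has_vector_derivative_def)
  qed
  have F: "((\<lambda>x. f (cube_point k x)) has_derivative
           (\<lambda>h. \<Sum>l<k. h $ crd l *\<^sub>R partial l f (cube_point k (p s0)))) (at (p s0) within p ` S)"
    using \<gamma> cp by (intro has_derivative_subset[OF cube_has_derivative[OF k U f]])
      (auto simp: p_def pad_unit_box)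
  have "((\<lambda>s. f (cube_point k (p s))) has_vector_derivative
      (\<Sum>l<k. (pad k \<gamma>' :: real ^ 'm) $ crd l *\<^sub>R partial l f (cube_point k (p s0)))) (at s0 within S)"
    using vector_derivative_diff_chain_within[OF p F] by (simp add: o_def)
  moreover have "(pad k \<gamma>' :: real ^ 'm) $ crd l = \<gamma>' l" if "l < k" for l
    using that k by (simp add: pad_def index_crd)
  ultimately have "((\<lambda>s. f (cube_point k (p s))) has_vector_derivative
      (\<Sum>l<k. \<gamma>' l *\<^sub>R partial l f (\<gamma> s0))) (at s0 within S)"
    using cp[OF \<gamma>(2)] by simp
  then show ?thesis
    by (rule has_vector_derivative_transform[OF \<gamma>(2), rotated]) (simp add: cp)
qed

subsection \<open>Alternating forms\<close>

text \<open>Used for two kinds of sequences: for vectors it undoes the deletion of entry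
  \<open>i\<close>, and for cube points it embeds a cube of one dimension less as the slice at
  height \<open>s\<close> in direction \<open>i\<close>.\<close>

definition ins :: "nat \<Rightarrow> 'b \<Rightarrow> (nat \<Rightarrow> 'b) \<Rightarrow> nat \<Rightarrow> 'b" where
  "ins i s t = (\<lambda>j. if j < i then t j else if j = i then s else t (j - 1))"

text \<open>The increasing enumeration of the naturals other than \<open>i\<close>.\<close>

definition skip :: "nat \<Rightarrow> nat \<Rightarrow> nat" where
  "skip i j = (if j < i then j else Suc j)"

lemma omit_skip: "omit i v = (\<lambda>j. v (skip i j))"
  by (auto simp: omit_def skip_def)

lemma alternating_formD:
  assumes "alternating_form k f"
  shows "(\<And>i. i < k \<Longrightarrow> v i = w i) \<Longrightarrow> f v = f w"
    and "i < k \<Longrightarrow> linear (\<lambda>u. f (v(i := u)))"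
    and "i < k \<Longrightarrow> j < k \<Longrightarrow> i \<noteq> j \<Longrightarrow> v i = v j \<Longrightarrow> f v = 0"
proof -
  note D = assms[unfolded alternating_form_def]
  show "(\<And>i. i < k \<Longrightarrow> v i = w i) \<Longrightarrow> f v = f w"
    using D[THEN conjunct1] by blast
  show "i < k \<Longrightarrow> linear (\<lambda>u. f (v(i := u)))"
    by (rule D[THEN conjunct2, THEN conjunct1, rule_format])
  show "i < k \<Longrightarrow> j < k \<Longrightarrow> i \<noteq> j \<Longrightarrow> v i = v j \<Longrightarrow> f v = 0"
    using D[THEN conjunct2, THEN conjunct2] by blast
qed

text \<open>Multilinear expansion. For the induction only the first \<open>m\<close> arguments are
  sums and the others are arbitrary; a new choice \<open>l\<close> for argument \<open>m\<close>
  extends \<open>\<phi>\<close> by one value.\<close>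

lemma alternating_form_sum:
  fixes w :: "'i \<Rightarrow> real ^ 'n::finite"
  assumes f: "alternating_form k f" and L: "finite L"
  shows "f (\<lambda>j. \<Sum>l\<in>L. A j l *\<^sub>R w l) = (\<Sum>\<phi>\<in>{..<k} \<rightarrow>\<^sub>E L. (\<Prod>j<k. A j (\<phi> j)) * f (\<lambda>j. w (\<phi> j)))"
proof -
  define S where "S j = (\<Sum>l\<in>L. A j l *\<^sub>R w l)" for j
  have "f (\<lambda>j. if j < m then S j else v j)
      = (\<Sum>\<phi>\<in>{..<m} \<rightarrow>\<^sub>E L. (\<Prod>j<m. A j (\<phi> j)) * f (\<lambda>j. if j < m then w (\<phi> j) else v j))"
    if "m \<le> k" for m v
    using that
  proof (induction m arbitrary: v)
    case (Suc m)
    define g where "g \<phi> = (\<lambda>j. if j < m then w (\<phi> j) else v j)" for \<phi>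
    have lin: "f ((g \<phi>)(m := S m)) = (\<Sum>l\<in>L. A m l * f ((g \<phi>)(m := w l)))" for \<phi>
    proof -
      have "linear (\<lambda>u. f ((g \<phi>)(m := u)))"
        using alternating_formD(2)[OF f] Suc.prems by simp
      from linear_sum[OF this, of "\<lambda>l. A m l *\<^sub>R w l" L] linear_scale[OF this]
      show ?thesis by (simp add: S_def)
    qed
    have "(\<lambda>j. if j < Suc m then S j else v j) = (\<lambda>j. if j < m then S j else (v(m := S m)) j)"
      by (auto simp: less_Suc_eq)
    moreover have "(\<lambda>j. if j < m then w (\<phi> j) else (v(m := S m)) j) = (g \<phi>)(m := S m)" for \<phi>
      by (auto simp: g_def)
    ultimately have "f (\<lambda>j. if j < Suc m then S j else v j)
        = (\<Sum>\<phi>\<in>{..<m} \<rightarrow>\<^sub>E L. (\<Prod>j<m. A j (\<phi> j)) * f ((g \<phi>)(m := S m)))"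
      using Suc.IH[of "v(m := S m)"] Suc.prems by simp
    also have "\<dots> = (\<Sum>\<phi>\<in>{..<m} \<rightarrow>\<^sub>E L. \<Sum>l\<in>L. (\<Prod>j<m. A j (\<phi> j)) * A m l * f ((g \<phi>)(m := w l)))"
      by (simp add: lin sum_distrib_left mult.assoc)
    also have "\<dots> = (\<Sum>(l, \<phi>)\<in>L \<times> ({..<m} \<rightarrow>\<^sub>E L). (\<Prod>j<m. A j (\<phi> j)) * A m l * f ((g \<phi>)(m := w l)))"
      by (subst sum.swap) (simp add: sum.cartesian_product)
    also have "\<dots> = (\<Sum>\<phi>\<in>{..<Suc m} \<rightarrow>\<^sub>E L. (\<Prod>j<Suc m. A j (\<phi> j)) * f (\<lambda>j. if j < Suc m then w (\<phi> j) else v j))"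
    proof -
      have "{..<Suc m} \<rightarrow>\<^sub>E L = (\<lambda>(y, g). g(m := y)) ` (L \<times> ({..<m} \<rightarrow>\<^sub>E L))"
        by (simp add: lessThan_Suc PiE_insert_eq)
      moreover have inj: "inj_on (\<lambda>(y, g). g(m := y)) (L \<times> ({..<m} \<rightarrow>\<^sub>E L))"
        by (rule inj_combinator) simp
      moreover have "(\<lambda>j. if j < Suc m then w ((\<phi>(m := l)) j) else v j) = (g \<phi>)(m := w l)" for \<phi> l
        by (auto simp: g_def)
      ultimately show ?thesis
        by (simp only: sum.reindex[OF inj]) (auto intro!: sum.cong)
    qed
    finally show ?case .
  qed simp
  from this[of k S] have main: "f (\<lambda>j. if j < k then S j else S j)
      = (\<Sum>\<phi>\<in>{..<k} \<rightarrow>\<^sub>E L. (\<Prod>j<k. A j (\<phi> j)) * f (\<lambda>j. if j < k then w (\<phi> j) else S j))"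
    by simp
  have "f (\<lambda>j. if j < k then w (\<phi> j) else S j) = f (\<lambda>j. w (\<phi> j))" for \<phi>
    by (rule alternating_formD(1)[OF f]) simp
  with main show ?thesis
    by (simp add: S_def[abs_def])
qed

text \<open>Polarization: the form vanishes when \<open>v i + v j\<close> stands in both places;
  expanding leaves the two mixed terms.\<close>

lemma alternating_form_swap:
  assumes f: "alternating_form k f" and ij: "i < k" "j < k" "i \<noteq> j"
  shows "f (v(i := v j, j := v i)) = - f v"
proof -
  define B where "B x y = f (v(i := x, j := y))" for x y
  have add1: "B (x + x') y = B x y + B x' y" for x x' y
    using linear_add[OF alternating_formD(2)[OF f ij(1), of "v(j := y)"]] ij(3)
    by (simp add: B_def fun_upd_twist)
  have add2: "B x (y + y') = B x y + B x y'" for x y y'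
    using linear_add[OF alternating_formD(2)[OF f ij(2), of "v(i := x)"]] by (simp add: B_def)
  have diag: "B x x = 0" for x
    unfolding B_def using ij by (intro alternating_formD(3)[OF f ij]) simp
  have "B (v j) (v i) = - B (v i) (v j)"
    using diag[of "v i + v j"] diag[of "v i"] diag[of "v j"] unfolding add1 add2 by linarith
  then show ?thesis by (simp add: B_def)
qed

lemma alternating_form_permutes:
  assumes f: "alternating_form k f" and p: "p permutes {..<k}"
  shows "f (\<lambda>j. w (p j)) = of_int (sign p) * f w"
  using p finite_lessThan
proof (induction arbitrary: w rule: permutes_induct)
  case (swap a b p)
  have perm: "permutation p" using swap(4) permutation_permutes by blast
  show ?case
  proof (cases "a = b")
    case False
    have eq: "w \<circ> Transposition.transpose a b = w(a := w b, b := w a)"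
      by (simp add: fun_eq_iff Transposition.transpose_def)
    have "f (\<lambda>j. (w \<circ> Transposition.transpose a b) (p j)) = of_int (sign p) * f (w \<circ> Transposition.transpose a b)"
      by (rule swap.IH)
    then have "f (\<lambda>j. w ((Transposition.transpose a b \<circ> p) j)) = of_int (sign p) * f (w \<circ> Transposition.transpose a b)"
      by (simp only: o_def)
    also have "\<dots> = of_int (sign p) * f (w(a := w b, b := w a))"
      by (simp only: eq)
    also have "\<dots> = - of_int (sign p) * f w"
      using alternating_form_swap[OF f, of a b w] swap(1,2) False by simp
    also have "- of_int (sign p) = of_int (sign (Transposition.transpose a b \<circ> p))"
      using False sign_compose[OF permutation_swap_id perm, of a b] by (simp add: sign_swap_id del: o_apply)
    finally show ?thesis .
  qed (use swap in simp)
qed simp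

text \<open>In the multilinear expansion a choice function with a repeated value contributes 0. The
  injective ones are the restrictions of permutations, and reordering the arguments produces the
  sign, so the factor is the Leibniz formula for the determinant of \<open>A\<close>.\<close>

lemma alternating_form_det:
  assumes f: "alternating_form k f"
  shows "f (\<lambda>j. \<Sum>l<k. A j l *\<^sub>R w l)
    = (\<Sum>p | p permutes {..<k}. of_int (sign p) * (\<Prod>j<k. A j (p j))) * f w"
proof -
  let ?P = "{p. p permutes {..<k}}"
  define T where "T \<phi> = (\<Prod>j<k. A j (\<phi> j)) * f (\<lambda>j. w (\<phi> j))" for \<phi>
  have im: "(\<lambda>p. restrict p {..<k}) ` ?P \<subseteq> {..<k} \<rightarrow>\<^sub>E {..<k}"
  proof
    fix \<phi> assume "\<phi> \<in> (\<lambda>p. restrict p {..<k}) ` ?P"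
    then obtain p where "p permutes {..<k}" "\<phi> = restrict p {..<k}" by blast
    then show "\<phi> \<in> {..<k} \<rightarrow>\<^sub>E {..<k}"
      using permutes_in_image[of p "{..<k}"] by (simp add: PiE_iff)
  qed
  have zero: "T \<phi> = 0" if \<phi>: "\<phi> \<in> ({..<k} \<rightarrow>\<^sub>E {..<k}) - (\<lambda>p. restrict p {..<k}) ` ?P" for \<phi>
  proof -
    have "\<not> inj_on \<phi> {..<k}"
    proof
      assume inj: "inj_on \<phi> {..<k}"
      define p where "p j = (if j < k then \<phi> j else j)" for j
      have "inj_on p {..<k}" using inj by (simp add: p_def inj_on_def)
      moreover have "p ` {..<k} \<subseteq> {..<k}" using \<phi> by (auto simp: p_def PiE_iff)
      ultimately have "p ` {..<k} = {..<k}" by (simp add: endo_inj_surj)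
      then have "p permutes {..<k}"
        using \<open>inj_on p _\<close> by (intro bij_imp_permutes) (auto simp: bij_betw_def p_def)
      moreover have "\<phi> = restrict p {..<k}"
        using \<phi> by (auto simp: p_def PiE_iff extensional_def)
      ultimately show False using \<phi> by blast
    qed
    then obtain i j where "i < k" "j < k" "i \<noteq> j" "\<phi> i = \<phi> j"
      by (auto simp: inj_on_def)
    then show ?thesis
      using alternating_formD(3)[OF f, of i j "\<lambda>j. w (\<phi> j)"] by (simp add: T_def)
  qed
  have inj: "inj_on (\<lambda>p. restrict p {..<k}) ?P"
  proof (rule inj_onI, rule ext)
    fix p q x assume pq: "p \<in> ?P" "q \<in> ?P" "restrict p {..<k} = restrict q {..<k}"
    have "x < k \<Longrightarrow> p x = q x"
      using fun_cong[OF pq(3), of x] by simp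
    then show "p x = q x"
      using pq(1,2) by (cases "x < k") (auto simp: permutes_def)
  qed
  have "f (\<lambda>j. \<Sum>l<k. A j l *\<^sub>R w l) = (\<Sum>\<phi>\<in>{..<k} \<rightarrow>\<^sub>E {..<k}. T \<phi>)"
    unfolding T_def by (rule alternating_form_sum[OF f]) simp
  also have "\<dots> = (\<Sum>\<phi>\<in>(\<lambda>p. restrict p {..<k}) ` ?P. T \<phi>)"
    using im zero by (intro sum.mono_neutral_right) (auto intro!: finite_PiE)
  also have "\<dots> = (\<Sum>p\<in>?P. T (restrict p {..<k}))"
    by (simp add: sum.reindex[OF inj] o_def)
  also have "\<dots> = (\<Sum>p\<in>?P. of_int (sign p) * (\<Prod>j<k. A j (p j)) * f w)"
  proof (rule sum.cong[OF refl])
    fix p assume "p \<in> ?P"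
    moreover have "f (\<lambda>j. w (restrict p {..<k} j)) = f (\<lambda>j. w (p j))"
      by (rule alternating_formD(1)[OF f]) simp
    ultimately show "T (restrict p {..<k}) = of_int (sign p) * (\<Prod>j<k. A j (p j)) * f w"
      using alternating_form_permutes[OF f, of p w] by (simp add: T_def)
  qed
  finally show ?thesis by (simp add: sum_distrib_right)
qed

text \<open>Moving the inserted vector to the front takes \<open>p\<close> swaps of
  neighbours.\<close>

lemma alternating_form_ins:
  assumes f: "alternating_form k f" and "p < k"
  shows "f (ins p H w) = (-1) ^ p * f (ins 0 H w)"
  using \<open>p < k\<close>
proof (induction p)
  case (Suc p)
  have "ins (Suc p) H w = (ins p H w)(p := ins p H w (Suc p), Suc p := ins p H w p)"
    by (auto simp: ins_def)
  then have "f (ins (Suc p) H w) = - f (ins p H w)"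
    using alternating_form_swap[OF f, of p "Suc p" "ins p H w"] Suc.prems by simp
  then show ?case using Suc by simp
qed simp

text \<open>The cancellation behind \<open>d\<^sup>2 = 0\<close>: a symmetric second-order term inserted at the places
  of two omitted vectors occurs twice, with opposite signs.\<close>

lemma alternating_form_symmetric_cancel:
  assumes f: "alternating_form k f" and H: "\<And>i j. i \<le> k \<Longrightarrow> j \<le> k \<Longrightarrow> H i j = H j i"
  shows "(\<Sum>i\<le>k. (-1) ^ i * (\<Sum>j<k. f ((omit i V)(j := H i (skip i j))))) = 0"
proof -
  \<comment> \<open>A normal form: with the inserted vector moved to the front, a term depends only
    on its sign, on the value of \<open>H\<close> and on the pair of omitted entries.\<close>
  define T where "T = (\<lambda>(i, j). (-1) ^ (i + j) * f (ins 0 (H i (skip i j)) (omit j (omit i V))))"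
  define P Q where "P = {(i, j). i \<le> k \<and> j < k \<and> j < i}" and "Q = {(i, j). i \<le> k \<and> j < k \<and> i \<le> j}"
  have PQ: "{..k} \<times> {..<k} = P \<union> Q" "P \<inter> Q = {}" by (auto simp: P_def Q_def)
  then have fin: "finite P" "finite Q" by (metis finite_Un finite_SigmaI finite_atMost finite_lessThan)+
  have "(\<Sum>i\<le>k. (-1) ^ i * (\<Sum>j<k. f ((omit i V)(j := H i (skip i j))))) = (\<Sum>i\<le>k. \<Sum>j<k. T (i, j))"
    unfolding sum_distrib_left
  proof (intro sum.cong refl)
    fix i j assume "j \<in> {..<k}"
    moreover have "(omit i V)(j := X) = ins j X (omit j (omit i V))" for X
      by (auto simp: ins_def omit_def fun_eq_iff)
    ultimately show "(-1) ^ i * f ((omit i V)(j := H i (skip i j))) = T (i, j)"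
      using alternating_form_ins[OF f, of j] by (simp add: T_def power_add)
  qed
  also have "\<dots> = sum T P + sum T Q"
    unfolding sum.cartesian_product using PQ fin by (simp add: sum.union_disjoint)
  \<comment> \<open>Omitting \<open>i\<close> and then \<open>j\<close>, for
    \<open>i \<le> j\<close>, removes the original entries \<open>i\<close> and
    \<open>Suc j\<close>, as does omitting \<open>Suc j\<close> and then \<open>i\<close>. The
    exponent of the sign grows by one and the arguments of \<open>H\<close> are exchanged.\<close>
  also have "sum T Q = (\<Sum>x\<in>P. - T x)"
  proof (rule sum.reindex_bij_witness[where i = "\<lambda>(i, j). (j, i - 1)" and j = "\<lambda>(i, j). (Suc j, i)"])
    fix x assume "x \<in> Q"
    then obtain i j where x: "x = (i, j)" "i \<le> k" "j < k" "i \<le> j" by (auto simp: Q_def)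
    have "omit i (omit (Suc j) V) = omit j (omit i V)"
      using x by (auto simp: omit_def fun_eq_iff)
    then show "- T (case x of (i, j) \<Rightarrow> (Suc j, i)) = T x"
      using x H[of i "Suc j"] by (simp add: T_def skip_def add.commute)
  qed (auto simp: P_def Q_def)
  finally show ?thesis by (simp only: sum_negf)
qed

subsection \<open>Forms along curves\<close>

lemma formsD:
  assumes "a \<in> forms M p" "c \<in> atlas M"
  shows "x \<in> codom c \<Longrightarrow> alternating_form p (a c x)"
    and "smooth_on (codom c) (\<lambda>x. a c x v)"
    and "c' \<in> atlas M \<Longrightarrow> x \<in> overlap c c' \<Longrightarrow>
      a c x v = a c' (transition c c' x) (\<lambda>i. transition_deriv c c' x (v i))"
proof -
  note D = assms(1)[unfolded forms_def mem_Collect_eq, THEN conjunct2]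
  show "x \<in> codom c \<Longrightarrow> alternating_form p (a c x)"
    using bspec[OF D[THEN conjunct1] assms(2)] by blast
  show "smooth_on (codom c) (\<lambda>x. a c x v)"
    by (rule bspec[OF D[THEN conjunct1] assms(2), THEN conjunct2, THEN spec])
  show "c' \<in> atlas M \<Longrightarrow> x \<in> overlap c c' \<Longrightarrow>
      a c x v = a c' (transition c c' x) (\<lambda>i. transition_deriv c c' x (v i))"
    by (rule D[THEN conjunct2, rule_format, OF assms(2)])
qed

lemma smooth_onD:
  assumes "smooth_on S f"
  shows "continuous_on S f"
    and "x \<in> S \<Longrightarrow> (f has_derivative frechet_derivative f (at x within S)) (at x within S)"
    and "continuous_on S (\<lambda>x. frechet_derivative f (at x within S) v)"
proof -
  have "Cr_on (Suc 0) S f" using assms by (simp only: smooth_on_def)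
  then show "continuous_on S f" "continuous_on S (\<lambda>x. frechet_derivative f (at x within S) v)"
    "x \<in> S \<Longrightarrow> (f has_derivative frechet_derivative f (at x within S)) (at x within S)"
    by (simp_all add: differentiable_on_def frechet_derivative_works[symmetric])
qed

text \<open>Separates the arguments from the form: the remaining values are taken on constant basis
  vectors, which is where \<open>forms\<close> provides smoothness in the point.\<close>

lemma alternating_form_expand:
  fixes v :: "nat \<Rightarrow> real ^ 'n::finite"
  assumes "alternating_form p f"
  shows "f v = (\<Sum>\<phi>\<in>{..<p} \<rightarrow>\<^sub>E UNIV. (\<Prod>j<p. v j $ \<phi> j) * f (\<lambda>j. axis (\<phi> j) 1))"
proof -
  have "v = (\<lambda>j. \<Sum>m\<in>UNIV. v j $ m *\<^sub>R axis m 1)"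
    by (simp add: basis_expansion flip: scalar_mult_eq_scaleR)
  then have "f v = f (\<lambda>j. \<Sum>m\<in>UNIV. v j $ m *\<^sub>R axis m 1)"
    by (rule arg_cong)
  also have "\<dots> = (\<Sum>\<phi>\<in>{..<p} \<rightarrow>\<^sub>E UNIV. (\<Prod>j<p. v j $ \<phi> j) * f (\<lambda>j. axis (\<phi> j) 1))"
    by (rule alternating_form_sum[OF assms]) simp
  finally show ?thesis .
qed

lemma DERIV_prod_within:
  fixes f :: "'i \<Rightarrow> real \<Rightarrow> real"
  assumes "\<And>i. i \<in> I \<Longrightarrow> (f i has_real_derivative D i) (at x within S)"
  shows "((\<lambda>x. \<Prod>i\<in>I. f i x) has_real_derivative (\<Sum>i\<in>I. D i * (\<Prod>j\<in>I - {i}. f j x))) (at x within S)"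
proof -
  have "((\<lambda>x. \<Prod>i\<in>I. f i x) has_derivative (\<lambda>y. \<Sum>i\<in>I. (D i * y) * (\<Prod>j\<in>I - {i}. f j x))) (at x within S)"
    using assms by (intro has_derivative_prod) (simp add: has_field_derivative_def)
  moreover have "(\<lambda>y. \<Sum>i\<in>I. (D i * y) * (\<Prod>j\<in>I - {i}. f j x)) = (*) (\<Sum>i\<in>I. D i * (\<Prod>j\<in>I - {i}. f j x))"
    by (simp add: fun_eq_iff sum_distrib_left ac_simps)
  ultimately show ?thesis
    by (simp add: has_field_derivative_def)
qed

context
  fixes M :: "('a, 'n::finite) manifold" and a :: "('a, 'n) form" and p :: nat
    and c :: "('a, 'n) chart" and S :: "real set" and s0 :: real and y :: "real \<Rightarrow> real ^ 'n" and y'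
  assumes a: "a \<in> forms M p" and c: "c \<in> atlas M"
    and S: "s0 \<in> S" "at s0 within S \<noteq> bot"
    and y: "\<And>s. s \<in> S \<Longrightarrow> y s \<in> codom c" "(y has_vector_derivative y') (at s0 within S)"
begin

lemma form_const_has_derivative:
  "((\<lambda>s. a c (y s) v) has_vector_derivative
     frechet_derivative (\<lambda>x. a c x v) (at (y s0) within codom c) y') (at s0 within S)"
proof -
  have "((\<lambda>x. a c x v) has_derivative frechet_derivative (\<lambda>x. a c x v) (at (y s0) within codom c))
      (at (y s0) within y ` S)"
    using y(1) S(1) by (intro has_derivative_subset[OF smooth_onD(2)[OF formsD(2)[OF a c]]]) auto
  from vector_derivative_diff_chain_within[OF y(2) this] show ?thesis by (simp add: o_def)
qed

text \<open>The derivative within a coordinate image is applied only to velocities of curves, so that its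
  uniqueness within the image is not needed.\<close>

lemma frechet_derivative_form_expand:
  "frechet_derivative (\<lambda>x. a c x v) (at (y s0) within codom c) y' =
    (\<Sum>\<phi>\<in>{..<p} \<rightarrow>\<^sub>E UNIV. (\<Prod>j<p. v j $ \<phi> j) *
      frechet_derivative (\<lambda>x. a c x (\<lambda>j. axis (\<phi> j) 1)) (at (y s0) within codom c) y')"
proof (rule vector_derivative_unique_within[OF S(2) form_const_has_derivative])
  have "((\<lambda>s. \<Sum>\<phi>\<in>{..<p} \<rightarrow>\<^sub>E UNIV. (\<Prod>j<p. v j $ \<phi> j) * a c (y s) (\<lambda>j. axis (\<phi> j) 1)) has_vector_derivative
      (\<Sum>\<phi>\<in>{..<p} \<rightarrow>\<^sub>E UNIV. (\<Prod>j<p. v j $ \<phi> j) *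
        frechet_derivative (\<lambda>x. a c x (\<lambda>j. axis (\<phi> j) 1)) (at (y s0) within codom c) y')) (at s0 within S)"
    by (intro has_vector_derivative_sum has_vector_derivative_mult_right form_const_has_derivative)
  then show "((\<lambda>s. a c (y s) v) has_vector_derivative
      (\<Sum>\<phi>\<in>{..<p} \<rightarrow>\<^sub>E UNIV. (\<Prod>j<p. v j $ \<phi> j) *
        frechet_derivative (\<lambda>x. a c x (\<lambda>j. axis (\<phi> j) 1)) (at (y s0) within codom c) y')) (at s0 within S)"
    by (rule has_vector_derivative_transform[OF S(1), rotated])
       (rule alternating_form_expand[OF formsD(1)[OF a c y(1)]])
qed

text \<open>The product rule for a multilinear expression: the point moves with frozen arguments,
  then each argument moves in turn. After expansion in basis vectors it is the ordinary product rule
  for real functions, and the resulting sums are folded back into values of the form.\<close>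

lemma form_has_vector_derivative:
  assumes V: "\<And>j. j < p \<Longrightarrow> ((\<lambda>s. V s j) has_vector_derivative V' j) (at s0 within S)"
  shows "((\<lambda>s. a c (y s) (V s)) has_vector_derivative
    (frechet_derivative (\<lambda>x. a c x (V s0)) (at (y s0) within codom c) y'
      + (\<Sum>j<p. a c (y s0) ((V s0)(j := V' j))))) (at s0 within S)"
proof -
  let ?\<Phi> = "{..<p} \<rightarrow>\<^sub>E (UNIV :: 'n set)"
  define B where "B \<phi> x = a c x (\<lambda>j. axis (\<phi> j) 1)" for \<phi> :: "nat \<Rightarrow> 'n" and x
  define G where "G \<phi> = frechet_derivative (B \<phi>) (at (y s0) within codom c) y'" for \<phi>
  have B: "((\<lambda>s. B \<phi> (y s)) has_real_derivative G \<phi>) (at s0 within S)" for \<phi>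
    unfolding has_real_derivative_iff_has_vector_derivative G_def B_def
    by (rule form_const_has_derivative)
  have Vc: "((\<lambda>s. V s j $ m) has_real_derivative V' j $ m) (at s0 within S)" if "j < p" for j m
    unfolding has_real_derivative_iff_has_vector_derivative
    by (rule bounded_linear.has_vector_derivative[OF bounded_linear_vec_nth V[OF that]])
  have "((\<lambda>s. \<Sum>\<phi>\<in>?\<Phi>. (\<Prod>j<p. V s j $ \<phi> j) * B \<phi> (y s)) has_real_derivative
      (\<Sum>\<phi>\<in>?\<Phi>. (\<Sum>j<p. V' j $ \<phi> j * (\<Prod>l\<in>{..<p} - {j}. V s0 l $ \<phi> l)) * B \<phi> (y s0)
          + G \<phi> * (\<Prod>j<p. V s0 j $ \<phi> j))) (at s0 within S)"
    by (intro DERIV_sum DERIV_mult DERIV_prod_within B Vc) auto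
  then have deriv: "((\<lambda>s. a c (y s) (V s)) has_vector_derivative
      (\<Sum>\<phi>\<in>?\<Phi>. (\<Sum>j<p. V' j $ \<phi> j * (\<Prod>l\<in>{..<p} - {j}. V s0 l $ \<phi> l)) * B \<phi> (y s0)
          + G \<phi> * (\<Prod>j<p. V s0 j $ \<phi> j))) (at s0 within S)"
    unfolding has_real_derivative_iff_has_vector_derivative B_def
    by (rule has_vector_derivative_transform[OF S(1), rotated])
       (rule alternating_form_expand[OF formsD(1)[OF a c y(1)]])
  have "a c (y s0) ((V s0)(j := V' j)) =
      (\<Sum>\<phi>\<in>?\<Phi>. V' j $ \<phi> j * (\<Prod>l\<in>{..<p} - {j}. V s0 l $ \<phi> l) * B \<phi> (y s0))" if "j < p" for j
  proof -
    have "(\<Prod>l<p. ((V s0)(j := V' j)) l $ \<phi> l) = V' j $ \<phi> j * (\<Prod>l\<in>{..<p} - {j}. V s0 l $ \<phi> l)" for \<phi>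
      using that by (subst prod.remove[of _ j]) (auto intro!: prod.cong)
    then show ?thesis
      by (subst alternating_form_expand[OF formsD(1)[OF a c y(1)[OF S(1)]]]) (simp only: B_def)
  qed
  then have second: "(\<Sum>j<p. a c (y s0) ((V s0)(j := V' j))) =
      (\<Sum>\<phi>\<in>?\<Phi>. (\<Sum>j<p. V' j $ \<phi> j * (\<Prod>l\<in>{..<p} - {j}. V s0 l $ \<phi> l)) * B \<phi> (y s0))"
    by (simp add: sum_distrib_right sum.swap[of _ ?\<Phi>])
  have first: "frechet_derivative (\<lambda>x. a c x (V s0)) (at (y s0) within codom c) y'
      = (\<Sum>\<phi>\<in>?\<Phi>. G \<phi> * (\<Prod>j<p. V s0 j $ \<phi> j))"
    by (subst frechet_derivative_form_expand) (simp add: G_def B_def[abs_def] mult.commute)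
  show ?thesis
    unfolding first second using deriv by (simp only: sum.distrib add.commute)
qed

end

lemma continuous_on_form:
  assumes a: "a \<in> forms M p" "c \<in> atlas M"
    and x: "continuous_on U x" "\<And>t. t \<in> U \<Longrightarrow> x t \<in> codom c"
    and V: "\<And>j. j < p \<Longrightarrow> continuous_on U (\<lambda>t. V t j)"
  shows "continuous_on U (\<lambda>t. a c (x t) (V t))"
proof -
  have "continuous_on U (\<lambda>t. \<Sum>\<phi>\<in>{..<p} \<rightarrow>\<^sub>E UNIV. (\<Prod>j<p. V t j $ \<phi> j) * a c (x t) (\<lambda>j. axis (\<phi> j) 1))"
    by (intro continuous_intros V continuous_on_compose2[OF smooth_onD(1)[OF formsD(2)[OF a]] x(1)])
       (use x(2) in auto)
  then show ?thesis
    by (rule continuous_on_eq) (rule alternating_form_expand[OF formsD(1)[OF a x(2)], symmetric])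
qed

subsection \<open>Pullback to the cube\<close>

text \<open>Allows continuity on the cube to be checked in one chart at a time, since the preimages
  of chart domains are a relatively open cover.\<close>

lemma continuous_on_open_cover:
  fixes f :: "'x::topological_space \<Rightarrow> 'y::topological_space"
  assumes "\<And>t. t \<in> S \<Longrightarrow> \<exists>U. t \<in> U \<and> openin (top_of_set S) U \<and> continuous_on U f"
  shows "continuous_on S f"
  unfolding continuous_on_def
proof
  fix t assume "t \<in> S"
  then obtain U where U: "t \<in> U" "openin (top_of_set S) U" "continuous_on U f" using assms by blast
  then obtain W where W: "open W" "U = S \<inter> W" by (auto simp: openin_open)
  have "at t within S = at t within U"
    using W U(1) by (intro at_within_nhd[of _ W]) auto
  then show "(f \<longlongrightarrow> f t) (at t within S)"
    using U by (simp add: continuous_on_def)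
qed

definition some_chart :: "('a, 'n::finite) manifold \<Rightarrow> 'a \<Rightarrow> ('a, 'n) chart" where
  "some_chart M x = (SOME c. c \<in> atlas M \<and> x \<in> fst c)"

text \<open>The coefficient of the pulled back form on the coordinate directions
  \<open>\<sigma> 0\<close>, \<open>\<sigma> 1\<close> and so on. With \<open>id\<close> it is the
  integrand of a cell; with \<open>skip i\<close> it is the coefficient tangent to the faces in
  direction \<open>i\<close>.\<close>

definition pullback_coeff ::
  "('a, 'n::finite) manifold \<Rightarrow> ('a, 'n) form \<Rightarrow> ((nat \<Rightarrow> real) \<Rightarrow> 'a) \<Rightarrow> (nat \<Rightarrow> nat) \<Rightarrow> (nat \<Rightarrow> real) \<Rightarrow> real" where
  "pullback_coeff M a \<tau> \<sigma> t =
     (let c = some_chart M (\<tau> t) in a c (snd c (\<tau> t)) (\<lambda>j. partial (\<sigma> j) (\<lambda>t. snd c (\<tau> t)) t))"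

lemma cube_pullback_coeff: "cube_pullback M a \<tau> = pullback_coeff M a \<tau> id"
  by (simp add: fun_eq_iff cube_pullback_def pullback_coeff_def some_chart_def)

lemma transition_coord:
  assumes M: "oriented_manifold M" and c: "c \<in> atlas M" and x: "x \<in> fst c" "x \<in> fst c'"
  shows "transition c c' (snd c x) = snd c' x" "snd c x \<in> overlap c c'"
proof -
  have ch: "chart_on (mtop M) c" using M c by (simp add: oriented_manifold_def)
  then have "fst c \<subseteq> topspace (mtop M)" by (auto simp: chart_on_def dest: openin_subset)
  moreover have "inj_on (snd c) (topspace (subtopology (mtop M) (fst c)))"
    using ch by (intro homeomorphic_imp_injective_map) (auto simp: chart_on_def)
  ultimately have "inj_on (snd c) (fst c)" by (simp add: Int_absorb1)
  then show "transition c c' (snd c x) = snd c' x" using x by (simp add: transition_def)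
  show "snd c x \<in> overlap c c'" using x by (auto simp: overlap_def)
qed

text \<open>The degree \<open>p\<close> and the dimension \<open>K\<close> of the cube are kept
  apart: Stokes' theorem uses \<open>K = Suc p\<close>, invariance under reparametrization
  \<open>K = p\<close>.\<close>

locale cube_form =
  fixes M :: "('a, 'n::finite) manifold" and a :: "('a, 'n) form" and p K :: nat
    and \<tau> :: "(nat \<Rightarrow> real) \<Rightarrow> 'a"
  assumes M: "oriented_manifold M" and a: "a \<in> forms M p" and \<tau>: "singular_cube M K \<tau>"
begin

abbreviation coord :: "('a, 'n) chart \<Rightarrow> (nat \<Rightarrow> real) \<Rightarrow> real ^ 'n" where
  "coord c t \<equiv> snd c (\<tau> t)"

definition dom :: "('a, 'n) chart \<Rightarrow> (nat \<Rightarrow> real) set" where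
  "dom c = {t \<in> cube K. \<tau> t \<in> fst c}"

abbreviation velocity :: "('a, 'n) chart \<Rightarrow> (nat \<Rightarrow> real) \<Rightarrow> nat \<Rightarrow> real ^ 'n" where
  "velocity c t j \<equiv> partial j (coord c) t"

lemma some_chart:
  assumes "t \<in> cube K"
  shows "some_chart M (\<tau> t) \<in> atlas M" "t \<in> dom (some_chart M (\<tau> t))"
proof -
  have "\<tau> t \<in> topspace (mtop M)"
    using \<tau> assms by (auto simp: singular_cube_def continuous_map_def)
  also have "topspace (mtop M) = (\<Union>c\<in>atlas M. fst c)"
    using M by (simp add: oriented_manifold_def)
  finally have "\<exists>c. c \<in> atlas M \<and> \<tau> t \<in> fst c" by blast
  then have "some_chart M (\<tau> t) \<in> atlas M \<and> \<tau> t \<in> fst (some_chart M (\<tau> t))"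
    unfolding some_chart_def by (rule someI_ex)
  then show "some_chart M (\<tau> t) \<in> atlas M" "t \<in> dom (some_chart M (\<tau> t))"
    using assms by (auto simp: dom_def)
qed

lemma open_dom: "c \<in> atlas M \<Longrightarrow> openin (top_of_set (cube K)) (dom c)"
proof -
  assume "c \<in> atlas M"
  then have "openin (mtop M) (fst c)" using M by (simp add: oriented_manifold_def chart_on_def)
  moreover have "continuous_map (top_of_set (cube K)) (mtop M) \<tau>"
    using \<tau> by (simp add: singular_cube_def)
  ultimately have "openin (top_of_set (cube K)) {t \<in> topspace (top_of_set (cube K)). \<tau> t \<in> fst c}"
    by (rule openin_continuous_map_preimage[rotated])
  then show ?thesis by (simp add: dom_def)
qed

lemma coord_codom: "t \<in> dom c \<Longrightarrow> coord c t \<in> codom c"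
  by (auto simp: dom_def)

lemma coord_Cr: "c \<in> atlas M \<Longrightarrow> cube_Cr r K (dom c) (coord c)"
  using \<tau> by (simp add: singular_cube_def cube_smooth_def dom_def)

lemma has_velocity:
  assumes "c \<in> atlas M" "t \<in> dom c" "j < K"
  shows "((\<lambda>s. coord c (t(j := s))) has_vector_derivative velocity c t j) (at (t j) within {-1..1})"
  by (rule cube_CrD(4)[OF coord_Cr[OF assms(1)] assms(3,2)])

lemma dom_bounds: "t \<in> dom c \<Longrightarrow> j < K \<Longrightarrow> t j \<in> {-1..1}"
  by (rule cube_bounds[of _ K]) (simp_all add: dom_def)

text \<open>On a piece of the coordinate line that stays in both chart domains, the curve seen in
  \<open>c'\<close> is the transition map applied to the curve seen in \<open>c\<close>; the chain
  rule then applies within the overlap.\<close>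

lemma velocity_transition:
  assumes c: "c \<in> atlas M" "c' \<in> atlas M" and t: "t \<in> dom c" "t \<in> dom c'" and j: "j < K"
  shows "velocity c' t j = transition_deriv c c' (coord c t) (velocity c t j)"
proof -
  obtain d where d: "d > 0" "\<And>s. s \<in> {-1..1} \<inter> ball (t j) d \<Longrightarrow> t(j := s) \<in> dom c \<inter> dom c'"
    using cube_line_neighbourhood[OF openin_Int[OF open_dom[OF c(1)] open_dom[OF c(2)]] _ j] t by blast
  define S where "S = {-1..1} \<inter> ball (t j) d"
  have at_S: "at (t j) within S = at (t j) within {-1..1}"
    unfolding S_def by (rule at_within_interval_neighbourhood[OF d(1)])
  have tS: "t j \<in> S" using dom_bounds[OF t(1) j] d(1) by (simp add: S_def)
  have tr: "transition c c' (coord c (t(j := s))) = coord c' (t(j := s))"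
    "coord c (t(j := s)) \<in> overlap c c'" if "s \<in> S" for s
    using transition_coord[OF M c(1)] d(2)[of s] that by (auto simp: S_def dom_def)
  have "smooth_on (overlap c c') (transition c c')"
    using M c by (auto simp: oriented_manifold_def)
  moreover have "coord c t \<in> overlap c c'" using tr(2)[OF tS] by simp
  ultimately have "(transition c c' has_derivative transition_deriv c c' (coord c t)) (at (coord c t) within overlap c c')"
    unfolding transition_deriv_def by (intro smooth_onD(2))
  then have "(transition c c' has_derivative transition_deriv c c' (coord c t))
      (at (coord c (t(j := t j))) within (\<lambda>s. coord c (t(j := s))) ` S)"
    unfolding fun_upd_triv by (rule has_derivative_subset) (use tr(2) in auto)
  from vector_derivative_diff_chain_within[OF has_velocity[OF c(1) t(1) j, folded at_S] this]
  have "((\<lambda>s. coord c' (t(j := s))) has_vector_derivative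
      transition_deriv c c' (coord c t) (velocity c t j)) (at (t j) within S)"
    by (rule has_vector_derivative_transform[OF tS, rotated]) (simp add: tr)
  then show ?thesis
    unfolding at_S by (rule partial_eqI[of t j, OF dom_bounds[OF t(1) j]])
qed

text \<open>The transformation law of the form and that of the velocities match. Hence the arbitrary
  choice of a chart at each point, which may jump from point to point, leaves no trace, and on each
  chart domain the coefficient has one smooth expression.\<close>

lemma coeff_eq_chart:
  assumes c: "c \<in> atlas M" and t: "t \<in> dom c" and \<sigma>: "\<And>j. j < p \<Longrightarrow> \<sigma> j < K"
  shows "pullback_coeff M a \<tau> \<sigma> t = a c (coord c t) (\<lambda>j. velocity c t (\<sigma> j))"
proof -
  define c' where "c' = some_chart M (\<tau> t)"
  have tc: "t \<in> cube K" using t by (simp add: dom_def)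
  have c': "c' \<in> atlas M" "t \<in> dom c'" unfolding c'_def using some_chart[OF tc] by auto
  have tr: "transition c' c (coord c' t) = coord c t" "coord c' t \<in> overlap c' c"
    using transition_coord[OF M c'(1)] c'(2) t by (auto simp: dom_def)
  have "pullback_coeff M a \<tau> \<sigma> t = a c' (coord c' t) (\<lambda>j. velocity c' t (\<sigma> j))"
    by (simp add: pullback_coeff_def c'_def Let_def)
  also have "\<dots> = a c (coord c t) (\<lambda>j. transition_deriv c' c (coord c' t) (velocity c' t (\<sigma> j)))"
    unfolding formsD(3)[OF a c'(1) c tr(2)] tr(1) ..
  also have "\<dots> = a c (coord c t) (\<lambda>j. velocity c t (\<sigma> j))"
    by (rule alternating_formD(1)[OF formsD(1)[OF a c coord_codom[OF t]]])
       (rule velocity_transition[OF c'(1) c c'(2) t \<sigma>, symmetric])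
  finally show ?thesis .
qed

lemma continuous_on_coeff:
  assumes \<sigma>: "\<And>j. j < p \<Longrightarrow> \<sigma> j < K"
  shows "continuous_on (cube K) (pullback_coeff M a \<tau> \<sigma>)"
proof (rule continuous_on_open_cover)
  fix t assume t: "t \<in> cube K"
  define c where "c = some_chart M (\<tau> t)"
  have c: "c \<in> atlas M" "t \<in> dom c" unfolding c_def using some_chart[OF t] by auto
  have "continuous_on (dom c) (\<lambda>t. a c (coord c t) (\<lambda>j. velocity c t (\<sigma> j)))"
    by (intro continuous_on_form[OF a c(1)] cube_CrD(1,3)[OF coord_Cr[OF c(1)]] coord_codom \<sigma>)
  then have "continuous_on (dom c) (pullback_coeff M a \<tau> \<sigma>)"
    by (rule continuous_on_eq) (rule coeff_eq_chart[OF c(1) _ \<sigma>, symmetric])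
  with c open_dom show "\<exists>U. t \<in> U \<and> openin (top_of_set (cube K)) U \<and> continuous_on U (pullback_coeff M a \<tau> \<sigma>)"
    by blast
qed

text \<open>The product rule along the coordinate line \<open>i\<close>. The arguments of the form
  are velocities, so they contribute second derivatives of the cube. The second statement records
  the expansion of the first-order term in basis vectors, which the continuity of the partial
  derivatives relies on.\<close>

lemma coeff_has_vector_derivative:
  assumes c: "c \<in> atlas M" and t: "t \<in> dom c" and \<sigma>: "\<And>j. j < p \<Longrightarrow> \<sigma> j < K" and i: "i < K"
  shows "((\<lambda>s. pullback_coeff M a \<tau> \<sigma> (t(i := s))) has_vector_derivative
      (frechet_derivative (\<lambda>x. a c x (\<lambda>j. velocity c t (\<sigma> j))) (at (coord c t) within codom c) (velocity c t i)
        + (\<Sum>j<p. a c (coord c t) ((\<lambda>j. velocity c t (\<sigma> j))(j := partial i (partial (\<sigma> j) (coord c)) t)))))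
      (at (t i) within {-1..1})"
    and "frechet_derivative (\<lambda>x. a c x v) (at (coord c t) within codom c) (velocity c t i) =
      (\<Sum>\<phi>\<in>{..<p} \<rightarrow>\<^sub>E UNIV. (\<Prod>j<p. v j $ \<phi> j) *
        frechet_derivative (\<lambda>x. a c x (\<lambda>j. axis (\<phi> j) 1)) (at (coord c t) within codom c) (velocity c t i))"
proof -
  obtain d where d: "d > 0" "\<And>s. s \<in> {-1..1} \<inter> ball (t i) d \<Longrightarrow> t(i := s) \<in> dom c"
    using cube_line_neighbourhood[OF open_dom[OF c] t i] by blast
  define S where "S = {-1..1} \<inter> ball (t i) d"
  have at_S: "at (t i) within S = at (t i) within {-1..1}"
    unfolding S_def by (rule at_within_interval_neighbourhood[OF d(1)])
  have tS: "t i \<in> S" using dom_bounds[OF t i] d(1) by (simp add: S_def)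
  have bot: "at (t i) within S \<noteq> bot"
    unfolding at_S by (rule at_within_interval_neq_bot[OF dom_bounds[OF t i]])
  have y: "coord c (t(i := s)) \<in> codom c" if "s \<in> S" for s
    using d(2)[of s] that by (intro coord_codom) (simp add: S_def)
  note vel = has_velocity[OF c t i, folded at_S]
  have acc: "((\<lambda>s. velocity c (t(i := s)) (\<sigma> j)) has_vector_derivative partial i (partial (\<sigma> j) (coord c)) t)
      (at (t i) within S)" if "j < p" for j
    unfolding at_S
    by (rule cube_CrD(4)[OF cube_CrD(2)[OF coord_Cr[OF c] \<sigma>[OF that]] i t])
  have "((\<lambda>s. a c (coord c (t(i := s))) (\<lambda>j. velocity c (t(i := s)) (\<sigma> j))) has_vector_derivative
      (frechet_derivative (\<lambda>x. a c x (\<lambda>j. velocity c t (\<sigma> j))) (at (coord c t) within codom c) (velocity c t i)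
        + (\<Sum>j<p. a c (coord c t) ((\<lambda>j. velocity c t (\<sigma> j))(j := partial i (partial (\<sigma> j) (coord c)) t)))))
      (at (t i) within S)"
    using form_has_vector_derivative[OF a c tS bot y vel acc] unfolding fun_upd_triv .
  then show "((\<lambda>s. pullback_coeff M a \<tau> \<sigma> (t(i := s))) has_vector_derivative
      (frechet_derivative (\<lambda>x. a c x (\<lambda>j. velocity c t (\<sigma> j))) (at (coord c t) within codom c) (velocity c t i)
        + (\<Sum>j<p. a c (coord c t) ((\<lambda>j. velocity c t (\<sigma> j))(j := partial i (partial (\<sigma> j) (coord c)) t)))))
      (at (t i) within {-1..1})"
    unfolding at_S[symmetric]
    by (rule has_vector_derivative_transform[OF tS, rotated])
       (rule coeff_eq_chart[OF c d(2) \<sigma>], simp_all add: S_def)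
  show "frechet_derivative (\<lambda>x. a c x v) (at (coord c t) within codom c) (velocity c t i) =
      (\<Sum>\<phi>\<in>{..<p} \<rightarrow>\<^sub>E UNIV. (\<Prod>j<p. v j $ \<phi> j) *
        frechet_derivative (\<lambda>x. a c x (\<lambda>j. axis (\<phi> j) 1)) (at (coord c t) within codom c) (velocity c t i))"
    using frechet_derivative_form_expand[OF a c tS bot y vel] unfolding fun_upd_triv .
qed

lemma partial_coeff:
  assumes c: "c \<in> atlas M" and t: "t \<in> dom c" and \<sigma>: "\<And>j. j < p \<Longrightarrow> \<sigma> j < K" and i: "i < K"
  shows "partial i (pullback_coeff M a \<tau> \<sigma>) t =
      frechet_derivative (\<lambda>x. a c x (\<lambda>j. velocity c t (\<sigma> j))) (at (coord c t) within codom c) (velocity c t i)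
        + (\<Sum>j<p. a c (coord c t) ((\<lambda>j. velocity c t (\<sigma> j))(j := partial i (partial (\<sigma> j) (coord c)) t)))"
  by (rule partial_eqI[of t i, OF dom_bounds[OF t i] coeff_has_vector_derivative(1)[OF assms]])

lemma coeff_has_partial:
  assumes t: "t \<in> cube K" and \<sigma>: "\<And>j. j < p \<Longrightarrow> \<sigma> j < K" and i: "i < K"
  shows "((\<lambda>s. pullback_coeff M a \<tau> \<sigma> (t(i := s))) has_vector_derivative
      partial i (pullback_coeff M a \<tau> \<sigma>) t) (at (t i) within {-1..1})"
  using coeff_has_vector_derivative(1)[OF some_chart[OF t] \<sigma> i]
    partial_coeff[OF some_chart[OF t] \<sigma> i] by simp

text \<open>Needed for the fundamental theorem of calculus and for integrability. Base point,
  direction and arguments of the derivative of the form all vary with \<open>t\<close>, while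
  smoothness gives continuity in the base point alone; so arguments and direction are both expanded
  in basis vectors.\<close>

lemma continuous_on_partial_coeff:
  assumes \<sigma>: "\<And>j. j < p \<Longrightarrow> \<sigma> j < K" and i: "i < K"
  shows "continuous_on (cube K) (partial i (pullback_coeff M a \<tau> \<sigma>))"
proof (rule continuous_on_open_cover)
  fix t assume t: "t \<in> cube K"
  define c where "c = some_chart M (\<tau> t)"
  have c: "c \<in> atlas M" "t \<in> dom c" unfolding c_def using some_chart[OF t] by auto
  let ?D = "\<lambda>\<phi> x. frechet_derivative (\<lambda>x. a c x (\<lambda>j. axis (\<phi> j) 1)) (at x within codom c)"
  have lin: "linear (?D \<phi> x)" if "x \<in> codom c" for \<phi> x
    using smooth_onD(2)[OF formsD(2)[OF a c(1)] that] by (rule has_derivative_linear)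
  \<comment> \<open>Expansion in the direction rests on the linearity of the chosen derivative, and
    so holds for every \<open>u\<close>; expansion in the arguments is a statement about velocities
    only.\<close>
  have expand: "?D \<phi> x u = (\<Sum>m\<in>UNIV. u $ m * ?D \<phi> x (axis m 1))" if "x \<in> codom c" for \<phi> x u
  proof -
    have "?D \<phi> x u = ?D \<phi> x (\<Sum>m\<in>UNIV. u $ m *\<^sub>R axis m 1)"
      by (simp add: basis_expansion flip: scalar_mult_eq_scaleR)
    then show ?thesis using lin[OF that, of \<phi>] by (simp add: linear_sum linear_scale)
  qed
  have cont_x: "continuous_on (dom c) (coord c)"
    by (rule cube_CrD(1)[OF coord_Cr[OF c(1)]])
  have cont_v: "continuous_on (dom c) (\<lambda>t. velocity c t j)" if "j < K" for j
    using cube_CrD(3)[OF coord_Cr[OF c(1)] that] .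
  have cont_w: "continuous_on (dom c) (\<lambda>t. partial i (partial (\<sigma> j) (coord c)) t)" if "j < p" for j
    using cube_CrD(3)[OF cube_CrD(2)[OF coord_Cr[OF c(1)] \<sigma>[OF that]] i] .
  have cont_D: "continuous_on (dom c) (\<lambda>t. ?D \<phi> (coord c t) (velocity c t i))" for \<phi>
  proof (rule continuous_on_eq)
    show "continuous_on (dom c) (\<lambda>t. \<Sum>m\<in>UNIV. velocity c t i $ m * ?D \<phi> (coord c t) (axis m 1))"
      by (intro continuous_on_sum continuous_on_mult
          bounded_linear.continuous_on[OF bounded_linear_vec_nth] cont_v[OF i]
          continuous_on_compose2[OF smooth_onD(3)[OF formsD(2)[OF a c(1)]] cont_x])
         (auto dest: coord_codom)
    show "(\<Sum>m\<in>UNIV. velocity c t i $ m * ?D \<phi> (coord c t) (axis m 1)) = ?D \<phi> (coord c t) (velocity c t i)"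
      if "t \<in> dom c" for t
      by (rule expand[OF coord_codom[OF that], symmetric])
  qed
  have first: "continuous_on (dom c) (\<lambda>t. \<Sum>\<phi>\<in>{..<p} \<rightarrow>\<^sub>E UNIV. (\<Prod>j<p. velocity c t (\<sigma> j) $ \<phi> j) *
        ?D \<phi> (coord c t) (velocity c t i))"
    by (intro continuous_on_sum continuous_on_mult continuous_on_prod cont_D
          bounded_linear.continuous_on[OF bounded_linear_vec_nth] cont_v \<sigma>) simp
  have second: "continuous_on (dom c) (\<lambda>t. a c (coord c t) ((\<lambda>j. velocity c t (\<sigma> j))(l := partial i (partial (\<sigma> l) (coord c)) t)))"
    if l: "l < p" for l
  proof (rule continuous_on_form[OF a c(1) cont_x coord_codom])
    show "continuous_on (dom c) (\<lambda>t. ((\<lambda>j. velocity c t (\<sigma> j))(l := partial i (partial (\<sigma> l) (coord c)) t)) j)"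
      if "j < p" for j
      using cont_w[OF l] cont_v[OF \<sigma>[OF that]] by (cases "j = l") simp_all
  qed
  have "continuous_on (dom c) (\<lambda>t. (\<Sum>\<phi>\<in>{..<p} \<rightarrow>\<^sub>E UNIV. (\<Prod>j<p. velocity c t (\<sigma> j) $ \<phi> j) *
        ?D \<phi> (coord c t) (velocity c t i))
      + (\<Sum>j<p. a c (coord c t) ((\<lambda>j. velocity c t (\<sigma> j))(j := partial i (partial (\<sigma> j) (coord c)) t))))"
    by (rule continuous_on_add[OF first continuous_on_sum], rule second) simp
  then have "continuous_on (dom c) (partial i (pullback_coeff M a \<tau> \<sigma>))"
  proof (rule continuous_on_eq)
    fix t assume t: "t \<in> dom c"
    have expand_coeff: "frechet_derivative (\<lambda>x. a c x (\<lambda>j. velocity c t (\<sigma> j))) (at (coord c t) within codom c) (velocity c t i)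
      = (\<Sum>\<phi>\<in>{..<p} \<rightarrow>\<^sub>E UNIV. (\<Prod>j<p. velocity c t (\<sigma> j) $ \<phi> j) * ?D \<phi> (coord c t) (velocity c t i))"
      by (rule coeff_has_vector_derivative(2)[OF c(1) t \<sigma> i])
    show "(\<Sum>\<phi>\<in>{..<p} \<rightarrow>\<^sub>E UNIV. (\<Prod>j<p. velocity c t (\<sigma> j) $ \<phi> j) *
        ?D \<phi> (coord c t) (velocity c t i))
      + (\<Sum>j<p. a c (coord c t) ((\<lambda>j. velocity c t (\<sigma> j))(j := partial i (partial (\<sigma> j) (coord c)) t)))
      = partial i (pullback_coeff M a \<tau> \<sigma>) t"
      by (simp only: partial_coeff[OF c(1) t \<sigma> i] expand_coeff)
  qed
  with c open_dom show "\<exists>U. t \<in> U \<and> openin (top_of_set (cube K)) U \<and> continuous_on U (partial i (pullback_coeff M a \<tau> \<sigma>))"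
    by blast
qed

end

text \<open>In a chart the pullback of the exterior derivative differs from the alternating sum of the
  partial derivatives of the coefficients by terms with second derivatives of the cube, which cancel
  by symmetry.\<close>

lemma cube_pullback_ext_deriv:
  assumes M: "oriented_manifold M" and a: "a \<in> forms M p" and \<tau>: "singular_cube M (Suc p) \<tau>"
    and t: "t \<in> cube (Suc p)"
  shows "cube_pullback M (ext_deriv M p a) \<tau> t =
    (\<Sum>i\<le>p. (-1) ^ i * partial i (pullback_coeff M a \<tau> (skip i)) t)"
proof -
  interpret cube_form M a p "Suc p" \<tau> using M a \<tau> by unfold_locales
  define c where "c = some_chart M (\<tau> t)"
  have c: "c \<in> atlas M" "t \<in> dom c" unfolding c_def using some_chart[OF t] by auto
  define V where "V = velocity c t"
  have skip: "skip i j < Suc p" if "j < p" for i j using that by (simp add: skip_def)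
  have "(\<Sum>i\<le>p. (-1) ^ i * (\<Sum>j<p. a c (coord c t) ((omit i V)(j := partial i (partial (skip i j) (coord c)) t)))) = 0"
    by (rule alternating_form_symmetric_cancel[OF formsD(1)[OF a c(1) coord_codom[OF c(2)]],
          where H = "\<lambda>i j. partial i (partial j (coord c)) t"])
       (rule partial_commute[OF open_dom[OF c(1)] coord_Cr[OF c(1)] c(2)], auto)
  moreover have "cube_pullback M (ext_deriv M p a) \<tau> t =
    (\<Sum>i\<le>p. (-1) ^ i * frechet_derivative (\<lambda>x. a c x (omit i V)) (at (coord c t) within codom c) (V i))"
    using c coord_codom[OF c(2)]
    by (simp add: cube_pullback_coeff pullback_coeff_def Let_def c_def[symmetric] ext_deriv_def V_def)
  moreover have "partial i (pullback_coeff M a \<tau> (skip i)) t =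
      frechet_derivative (\<lambda>x. a c x (omit i V)) (at (coord c t) within codom c) (V i)
        + (\<Sum>j<p. a c (coord c t) ((omit i V)(j := partial i (partial (skip i j) (coord c)) t)))"
    if "i \<le> p" for i
    using partial_coeff[OF c, of "skip i" i] skip that by (simp add: omit_skip V_def)
  ultimately show ?thesis
    by (simp add: distrib_left sum.distrib)
qed

subsection \<open>Integration over the cube\<close>

abbreviation lborel_pow :: "nat set \<Rightarrow> (nat \<Rightarrow> real) measure" where
  "lborel_pow J \<equiv> PiM J (\<lambda>_. lborel)"

lemma product_sigma_finite_lborel: "product_sigma_finite (\<lambda>_. lborel :: real measure)"
  by (simp add: product_sigma_finite_def sigma_finite_lborel)

lemma sigma_finite_lborel_pow: "finite J \<Longrightarrow> sigma_finite_measure (lborel_pow J)"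
  by (rule product_sigma_finite.sigma_finite[OF product_sigma_finite_lborel])

lemma cube_sets: "cube k \<in> sets (lborel_pow {..<k})"
  unfolding cube_def by (rule sets_PiM_I_finite) auto

lemma measurable_pad: "(pad k :: _ \<Rightarrow> real ^ 'm::finite) \<in> borel_measurable (lborel_pow {..<k})"
  unfolding pad_def
proof (subst borel_measurable_euclidean_space, rule ballI)
  fix b :: "real ^ 'm" assume "b \<in> Basis"
  then obtain m where b: "b = axis m 1" by (auto simp: Basis_vec_def)
  show "(\<lambda>t. (\<chi> m. if cart_index m < k then t (cart_index m) else 0) \<bullet> b) \<in> borel_measurable (lborel_pow {..<k})"
    by (cases "cart_index m < k") (simp_all add: b inner_axis)
qed

lemma continuous_on_comp_cube_point:
  assumes "continuous_on (cube k) f"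
  shows "continuous_on unit_box (\<lambda>x. f (cube_point k x))"
  by (rule continuous_on_compose2[OF assms continuous_on_cube_point]) (auto simp: cube_point_cube)

lemma cube_point_pad_cube:
  "k \<le> CARD('m::finite) \<Longrightarrow> t \<in> cube k \<Longrightarrow> cube_point k (pad k t :: real ^ 'm) = t"
  by (rule cube_point_pad) (auto simp: cube_def PiE_iff)

lemma pad_unit_box_iff:
  assumes "k \<le> CARD('m::finite)" "t \<in> space (lborel_pow {..<k})"
  shows "(pad k t :: real ^ 'm) \<in> unit_box \<longleftrightarrow> t \<in> cube k"
proof
  assume "(pad k t :: real ^ 'm) \<in> unit_box"
  then have "cube_point k (pad k t :: real ^ 'm) \<in> cube k" by (rule cube_point_cube)
  then show "t \<in> cube k"
    using assms by (simp add: cube_point_pad space_PiM PiE_iff)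
qed (rule pad_unit_box)

text \<open>Continuity refers to the product topology and measurability to the product measure. Both
  meet on \<open>real ^ 'm\<close>: the function factors through \<open>pad\<close>, which is
  measurable, and a continuous function on a closed box, which is Borel.\<close>

lemma borel_measurable_cube:
  fixes f :: "(nat \<Rightarrow> real) \<Rightarrow> real"
  assumes k: "k \<le> CARD('m::finite)" and f: "continuous_on (cube k) f"
  shows "(\<lambda>t. indicator (cube k) t *\<^sub>R f t) \<in> borel_measurable (lborel_pow {..<k})"
proof -
  have "(\<lambda>x :: real ^ 'm. indicator unit_box x *\<^sub>R f (cube_point k x)) \<in> borel_measurable borel"
    by (rule borel_measurable_continuous_on_indicator[OF _ continuous_on_comp_cube_point[OF f]])
       (simp add: unit_box_cbox)
  then have "(\<lambda>t. indicator unit_box (pad k t :: real ^ 'm) *\<^sub>R f (cube_point k (pad k t :: real ^ 'm)))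
      \<in> borel_measurable (lborel_pow {..<k})"
    by (rule measurable_compose[OF measurable_pad])
  also have "?this \<longleftrightarrow> ?thesis"
    by (rule measurable_cong)
       (auto simp: indicator_def pad_unit_box_iff[OF k] cube_point_pad_cube[OF k])
  finally show ?thesis .
qed

lemma bounded_cube:
  fixes f :: "(nat \<Rightarrow> real) \<Rightarrow> real"
  assumes k: "k \<le> CARD('m::finite)" and f: "continuous_on (cube k) f"
  obtains B where "\<And>t. t \<in> cube k \<Longrightarrow> \<bar>f t\<bar> \<le> B"
proof -
  have "compact ((\<lambda>x. f (cube_point k x)) ` (unit_box :: (real ^ 'm) set))"
    by (rule compact_continuous_image[OF continuous_on_comp_cube_point[OF f]])
       (simp add: unit_box_cbox)
  then obtain B where B: "\<And>y. y \<in> (\<lambda>x. f (cube_point k x)) ` (unit_box :: (real ^ 'm) set) \<Longrightarrow> norm y \<le> B"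
    using compact_imp_bounded bounded_iff by metis
  have "\<bar>f t\<bar> \<le> B" if "t \<in> cube k" for t
    using B[OF imageI[OF pad_unit_box[OF that]]] cube_point_pad_cube[OF k that] by simp
  then show ?thesis using that by blast
qed

lemma emeasure_cube:
  "finite J \<Longrightarrow> emeasure (lborel_pow J) (J \<rightarrow>\<^sub>E {-1..1}) = 2 ^ card J"
proof -
  interpret product_sigma_finite "\<lambda>_. lborel :: real measure" by (rule product_sigma_finite_lborel)
  assume "finite J"
  then show ?thesis by (subst emeasure_PiM) simp_all
qed

lemma integrable_cube:
  fixes f :: "(nat \<Rightarrow> real) \<Rightarrow> real"
  assumes k: "k \<le> CARD('m::finite)" and f: "continuous_on (cube k) f"
  shows "set_integrable (lborel_pow {..<k}) (cube k) f"
proof -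
  obtain B where B: "\<And>t. t \<in> cube k \<Longrightarrow> \<bar>f t\<bar> \<le> B" using bounded_cube[OF assms] by blast
  have "emeasure (lborel_pow {..<k}) (cube k) < \<infinity>"
    unfolding cube_def by (simp add: emeasure_cube power_less_top_ennreal)
  \<comment> \<open>Measurability is known for the cut-off function, and the integrability criterion
    adds an indicator of its own; the doubled factor is idempotent.\<close>
  then have "integrable (lborel_pow {..<k}) (\<lambda>t. indicator (cube k) t *\<^sub>R (indicator (cube k) t *\<^sub>R f t))"
    by (intro integrableI_bounded_set_indicator[where B = B] cube_sets borel_measurable_cube[OF k f])
       (auto simp: B)
  then show ?thesis
    unfolding set_integrable_def by (rule back_subst[of "integrable _"]) (auto simp: indicator_def)
qed

section \<open>Fubini along one coordinate of the cube\<close>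

lemma bij_betw_skip:
  "i \<le> k \<Longrightarrow> bij_betw (skip i) {..<k} ({..<Suc k} - {i})"
  by (rule bij_betw_byWitness[where f' = "\<lambda>j. if j < i then j else j - 1"])
     (auto simp: skip_def split: if_splits)

lemma ins_skip: "ins i s t (skip i j) = t j"
  by (auto simp: ins_def skip_def)

lemma ins_cube:
  assumes "i \<le> k" "t \<in> extensional {..<k}"
  shows "ins i s t \<in> cube (Suc k) \<longleftrightarrow> t \<in> cube k \<and> s \<in> {-1..1}"
proof
  assume L: "ins i s t \<in> cube (Suc k)"
  have "t j \<in> {-1..1}" if "j < k" for j
    using cube_bounds[OF L, of "skip i j"] that by (simp add: ins_skip) (simp add: skip_def)
  moreover have "s \<in> {-1..1}"
    using cube_bounds[OF L, of i] assms by (simp add: ins_def)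
  ultimately show "t \<in> cube k \<and> s \<in> {-1..1}"
    using assms(2) by (simp add: cube_def PiE_iff)
next
  assume R: "t \<in> cube k \<and> s \<in> {-1..1}"
  then have "ins i s t j \<in> {-1..1}" if "j < Suc k" for j
    using that assms(1) cube_bounds[of t k j] cube_bounds[of t k "j - 1"] by (auto simp: ins_def)
  moreover have "ins i s t \<in> extensional {..<Suc k}"
    using assms by (auto simp: ins_def extensional_def)
  ultimately show "ins i s t \<in> cube (Suc k)"
    by (simp add: cube_def PiE_iff)
qed

lemma measurable_ins:
  assumes "i \<le> k"
  shows "(\<lambda>(t, s). ins i s t) \<in> measurable (lborel_pow {..<k} \<Otimes>\<^sub>M lborel) (lborel_pow {..<Suc k})"
  unfolding case_prod_beta
proof (rule measurable_PiM_single')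
  fix j assume j: "j \<in> {..<Suc k}"
  consider "j < i" | "j = i" | "i < j" by linarith
  then show "(\<lambda>x. ins i (snd x) (fst x) j) \<in> measurable (lborel_pow {..<k} \<Otimes>\<^sub>M lborel) lborel"
  proof cases
    case 1
    then have "(\<lambda>x. fst x j) \<in> measurable (lborel_pow {..<k} \<Otimes>\<^sub>M (lborel :: real measure)) lborel"
      using assms by (intro measurable_compose[OF measurable_fst] measurable_component_singleton) simp
    then show ?thesis using 1 by (simp add: ins_def)
  next
    case 3
    then have "(\<lambda>x. fst x (j - 1)) \<in> measurable (lborel_pow {..<k} \<Otimes>\<^sub>M (lborel :: real measure)) lborel"
      using j by (intro measurable_compose[OF measurable_fst] measurable_component_singleton) auto
    then show ?thesis using 3 by (simp add: ins_def)
  qed (simp add: ins_def)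
next
  show "(\<lambda>x. ins i (snd x) (fst x)) \<in> space (lborel_pow {..<k} \<Otimes>\<^sub>M lborel) \<rightarrow> {..<Suc k} \<rightarrow>\<^sub>E space lborel"
  proof (rule Pi_I)
    fix x :: "(nat \<Rightarrow> real) \<times> real" assume "x \<in> space (lborel_pow {..<k} \<Otimes>\<^sub>M lborel)"
    then have "fst x \<in> extensional {..<k}"
      by (simp add: space_pair_measure space_PiM PiE_iff mem_Times_iff)
    then have "ins i (snd x) (fst x) \<in> extensional {..<Suc k}"
      using assms by (simp add: ins_def extensional_def)
    then show "ins i (snd x) (fst x) \<in> {..<Suc k} \<rightarrow>\<^sub>E space lborel"
      by (simp add: PiE_iff)
  qed
qed

text \<open>A product measure is determined by its values on boxes, and the preimage of a box under
  insertion is the box of the other factors times factor \<open>i\<close>.\<close>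

lemma distr_ins:
  assumes i: "i \<le> k"
  shows "distr (lborel_pow {..<k} \<Otimes>\<^sub>M lborel) (lborel_pow {..<Suc k}) (\<lambda>(t, s). ins i s t) = lborel_pow {..<Suc k}"
proof (rule product_sigma_finite.PiM_eqI[OF product_sigma_finite_lborel])
  fix A :: "nat \<Rightarrow> real set" assume A: "\<And>j. j \<in> {..<Suc k} \<Longrightarrow> A j \<in> sets lborel"
  let ?A = "Pi\<^sub>E {..<k} (\<lambda>j. A (skip i j))"
  have skip: "skip i j \<in> {..<Suc k}" if "j < k" for j using that by (auto simp: skip_def)
  interpret product_sigma_finite "\<lambda>_. lborel :: real measure" by (rule product_sigma_finite_lborel)
  have "(\<lambda>(t, s). ins i s t) -` Pi\<^sub>E {..<Suc k} A \<inter> space (lborel_pow {..<k} \<Otimes>\<^sub>M lborel) = ?A \<times> A i"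
  proof (intro set_eqI iffI)
    fix x assume x: "x \<in> (\<lambda>(t, s). ins i s t) -` Pi\<^sub>E {..<Suc k} A \<inter> space (lborel_pow {..<k} \<Otimes>\<^sub>M lborel)"
    obtain t s where ts: "x = (t, s)" by fastforce
    have mem: "ins i s t j \<in> A j" if "j < Suc k" for j using x that ts by (auto simp: PiE_iff)
    have "t j \<in> A (skip i j)" if "j < k" for j
      using mem[of "skip i j"] skip[OF that] by (simp add: ins_skip)
    moreover have "s \<in> A i" using mem[of i] i by (simp add: ins_def)
    ultimately show "x \<in> ?A \<times> A i"
      using x ts by (simp add: space_pair_measure space_PiM PiE_iff)
  next
    fix x assume x: "x \<in> ?A \<times> A i"
    obtain t s where ts: "x = (t, s)" by fastforce
    have "ins i s t j \<in> A j" if "j < Suc k" for j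
    proof -
      consider "j < i" | "j = i" | "i < j" by linarith
      then show ?thesis
      proof cases
        case 1
        then have "t j \<in> A (skip i j)" using x ts i by (auto simp: PiE_iff)
        then show ?thesis using 1 by (simp add: ins_def skip_def)
      next
        case 3
        then have "t (j - 1) \<in> A (skip i (j - 1))" using x ts that by (auto simp: PiE_iff)
        then show ?thesis using 3 by (simp add: ins_def skip_def split: if_splits)
      qed (use x ts in \<open>simp add: ins_def\<close>)
    qed
    moreover have "ins i s t \<in> extensional {..<Suc k}"
      using x ts i by (auto simp: ins_def extensional_def PiE_iff)
    ultimately show "x \<in> (\<lambda>(t, s). ins i s t) -` Pi\<^sub>E {..<Suc k} A \<inter> space (lborel_pow {..<k} \<Otimes>\<^sub>M lborel)"
      using x ts by (simp add: space_pair_measure space_PiM PiE_iff)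
  qed
  then have "emeasure (distr (lborel_pow {..<k} \<Otimes>\<^sub>M lborel) (lborel_pow {..<Suc k}) (\<lambda>(t, s). ins i s t)) (Pi\<^sub>E {..<Suc k} A)
      = emeasure (lborel_pow {..<k} \<Otimes>\<^sub>M lborel) (?A \<times> A i)"
    using A by (subst emeasure_distr[OF measurable_ins[OF i]]) (auto intro!: sets_PiM_I_finite)
  also have "\<dots> = emeasure (lborel_pow {..<k}) ?A * emeasure lborel (A i)"
    using A i skip by (intro sigma_finite_measure.emeasure_pair_measure_Times[OF sigma_finite_lborel])
      (auto intro!: sets_PiM_I_finite)
  also have "emeasure (lborel_pow {..<k}) ?A = (\<Prod>j<k. emeasure lborel (A (skip i j)))"
    using A skip by (intro emeasure_PiM) auto
  also have "\<dots> = (\<Prod>j\<in>{..<Suc k} - {i}. emeasure lborel (A j))"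
    by (rule prod.reindex_bij_betw[OF bij_betw_skip[OF i]])
  also have "\<dots> * emeasure lborel (A i) = (\<Prod>j\<in>{..<Suc k}. emeasure lborel (A j))"
    using i by (subst prod.remove[of _ i]) (auto simp: mult.commute)
  finally show "emeasure (distr (lborel_pow {..<k} \<Otimes>\<^sub>M lborel) (lborel_pow {..<Suc k}) (\<lambda>(t, s). ins i s t)) (Pi\<^sub>E {..<Suc k} A)
      = (\<Prod>j\<in>{..<Suc k}. emeasure lborel (A j))" .
qed simp_all

text \<open>Fubini with coordinate \<open>i\<close> innermost, the form in which the fundamental
  theorem of calculus can be applied to a derivative in direction \<open>i\<close>.\<close>

lemma cube_integral_ins:
  fixes f :: "(nat \<Rightarrow> real) \<Rightarrow> real"
  assumes k: "Suc k \<le> CARD('m::finite)" and f: "continuous_on (cube (Suc k)) f" and i: "i \<le> k"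
  shows "(LINT t:cube (Suc k)|lborel_pow {..<Suc k}. f t)
    = (LINT t:cube k|lborel_pow {..<k}. (\<integral>s. indicator {-1..1} s *\<^sub>R f (ins i s t) \<partial>lborel))"
proof -
  let ?P = "lborel_pow {..<k}"
  let ?g = "\<lambda>t. indicator (cube (Suc k)) t *\<^sub>R f t"
  interpret P: sigma_finite_measure ?P by (rule sigma_finite_lborel_pow) simp
  interpret pair_sigma_finite ?P "lborel :: real measure" ..
  have g: "?g \<in> borel_measurable (lborel_pow {..<Suc k})" by (rule borel_measurable_cube[OF k f])
  have "integrable (distr (?P \<Otimes>\<^sub>M lborel) (lborel_pow {..<Suc k}) (\<lambda>(t, s). ins i s t)) ?g"
    using integrable_cube[OF k f] by (simp add: distr_ins[OF i] set_integrable_def)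
  then have int: "integrable (?P \<Otimes>\<^sub>M lborel) (\<lambda>x. ?g (case x of (t, s) \<Rightarrow> ins i s t))"
    by (simp only: integrable_distr_eq[OF measurable_ins[OF i] g])
  have "(LINT t:cube (Suc k)|lborel_pow {..<Suc k}. f t)
      = integral\<^sup>L (distr (?P \<Otimes>\<^sub>M lborel) (lborel_pow {..<Suc k}) (\<lambda>(t, s). ins i s t)) ?g"
    by (simp add: distr_ins[OF i] set_lebesgue_integral_def)
  also have "\<dots> = integral\<^sup>L (?P \<Otimes>\<^sub>M lborel) (\<lambda>x. ?g (case x of (t, s) \<Rightarrow> ins i s t))"
    by (rule integral_distr[OF measurable_ins[OF i] g])
  also have "\<dots> = (\<integral>t. (\<integral>s. ?g (ins i s t) \<partial>lborel) \<partial>?P)"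
    using integral_fst'[OF int] by simp
  also have "\<dots> = (LINT t:cube k|?P. (\<integral>s. indicator {-1..1} s *\<^sub>R f (ins i s t) \<partial>lborel))"
    unfolding set_lebesgue_integral_def
  proof (rule Bochner_Integration.integral_cong[OF refl])
    fix t assume "t \<in> space ?P"
    then have "indicator (cube (Suc k)) (ins i s t) = (indicator (cube k) t * indicator {-1..1} s :: real)" for s
      using ins_cube[OF i, of t s] by (simp add: space_PiM PiE_iff indicator_def)
    then show "(\<integral>s. ?g (ins i s t) \<partial>lborel)
        = indicator (cube k) t *\<^sub>R (\<integral>s. indicator {-1..1} s *\<^sub>R f (ins i s t) \<partial>lborel)"
      by (simp add: mult.assoc)
  qed
  finally show ?thesis .
qed

subsection \<open>Change of variables on the cube\<close>

text \<open>Unlike \<open>pad\<close>, it leaves the surplus coordinates free, which is what makes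
  it measure preserving.\<close>

definition merge_vec :: "nat \<Rightarrow> (nat \<Rightarrow> real) \<times> (nat \<Rightarrow> real) \<Rightarrow> real ^ 'm::finite" where
  "merge_vec k x = (\<chi> m. if cart_index m < k then fst x (cart_index m) else snd x (cart_index m))"

lemma measurable_merge_vec:
  "(merge_vec k :: _ \<Rightarrow> real ^ 'm::finite) \<in> borel_measurable (lborel_pow {..<k} \<Otimes>\<^sub>M lborel_pow {k..<CARD('m)})"
  unfolding merge_vec_def
proof (subst borel_measurable_euclidean_space, rule ballI)
  fix b :: "real ^ 'm" assume "b \<in> Basis"
  then obtain m where b: "b = axis m 1" by (auto simp: Basis_vec_def)
  let ?N = "lborel_pow {..<k} \<Otimes>\<^sub>M lborel_pow {k..<CARD('m)}"
  have "(\<lambda>x. if cart_index m < k then fst x (cart_index m) else snd x (cart_index m)) \<in> borel_measurable ?N"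
  proof (cases "cart_index m < k")
    case True
    then have "(\<lambda>x. fst x (cart_index m)) \<in> measurable ?N lborel"
      by (intro measurable_compose[OF measurable_fst] measurable_component_singleton) simp
    then show ?thesis using True by simp
  next
    case False
    then have "(\<lambda>x. snd x (cart_index m)) \<in> measurable ?N lborel"
      by (intro measurable_compose[OF measurable_snd] measurable_component_singleton)
         (simp add: cart_index_less)
    then show ?thesis using False by simp
  qed
  then show "(\<lambda>x. (\<chi> m. if cart_index m < k then fst x (cart_index m) else snd x (cart_index m)) \<bullet> b)
      \<in> borel_measurable ?N"
    by (simp add: b inner_axis)
qed

lemma prod_Basis_vec:
  fixes h :: "real ^ 'm::finite \<Rightarrow> 'b::comm_monoid_mult"
  shows "(\<Prod>b\<in>Basis. h b) = (\<Prod>m\<in>UNIV. h (axis m 1))"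
proof -
  have "(Basis :: (real ^ 'm) set) = range (\<lambda>m. axis m 1)" by (auto simp: Basis_vec_def)
  moreover have inj: "inj (\<lambda>m :: 'm. axis m (1::real))" by (auto simp: inj_on_def axis_eq_axis)
  ultimately show ?thesis using prod.reindex[OF inj, of h] by (simp only: o_def)
qed

lemma all_crd: "(\<forall>m :: 'm::finite. P m) \<longleftrightarrow> (\<forall>i<CARD('m). P (crd i :: 'm))"
  by (metis cart_index_less crd_index)

lemma prod_cart_index: "(\<Prod>m\<in>UNIV. h (cart_index (m :: 'm::finite))) = (\<Prod>i<CARD('m). h i)"
  by (rule prod.reindex_bij_betw[OF bij_cart_index])

text \<open>Lebesgue measure is determined by its values on boxes, and here the preimage of a box is
  a product of two boxes.\<close>

lemma distr_merge_vec:
  assumes k: "k \<le> CARD('m::finite)"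
  shows "lborel = distr (lborel_pow {..<k} \<Otimes>\<^sub>M lborel_pow {k..<CARD('m)}) borel (merge_vec k :: _ \<Rightarrow> real ^ 'm)"
proof (rule lborel_eqI)
  fix l u :: "real ^ 'm" assume lu: "\<And>b. b \<in> Basis \<Longrightarrow> l \<bullet> b \<le> u \<bullet> b"
  let ?J = "{k..<CARD('m)}"
  let ?N = "lborel_pow {..<k} \<Otimes>\<^sub>M lborel_pow ?J"
  let ?I = "\<lambda>i. {l $ crd i<..<u $ crd i}"
  have le: "l $ m \<le> u $ m" for m
  proof -
    have "axis m 1 \<in> (Basis :: (real ^ 'm) set)" by (auto simp: Basis_vec_def)
    from lu[OF this] show ?thesis by (simp add: inner_axis)
  qed
  interpret product_sigma_finite "\<lambda>_. lborel :: real measure" by (rule product_sigma_finite_lborel)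
  have "merge_vec k -` box l u \<inter> space ?N = Pi\<^sub>E {..<k} ?I \<times> Pi\<^sub>E ?J ?I"
  proof (intro set_eqI iffI)
    fix x :: "(nat \<Rightarrow> real) \<times> (nat \<Rightarrow> real)"
    assume x: "x \<in> merge_vec k -` box l u \<inter> space ?N"
    then have box: "(merge_vec k x :: real ^ 'm) $ m \<in> {l $ m<..<u $ m}" for m
      by (simp add: mem_box_cart)
    have "fst x i \<in> ?I i" if "i < k" for i
      using box[of "crd i"] that k by (simp add: merge_vec_def index_crd)
    moreover have "snd x i \<in> ?I i" if "i \<in> ?J" for i
      using box[of "crd i"] that k by (simp add: merge_vec_def index_crd)
    ultimately show "x \<in> Pi\<^sub>E {..<k} ?I \<times> Pi\<^sub>E ?J ?I"
      using x by (simp add: space_pair_measure space_PiM mem_Times_iff PiE_iff)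
  next
    fix x :: "(nat \<Rightarrow> real) \<times> (nat \<Rightarrow> real)"
    assume x: "x \<in> Pi\<^sub>E {..<k} ?I \<times> Pi\<^sub>E ?J ?I"
    have first: "fst x i \<in> ?I i" if "i < k" for i using x that by (simp add: mem_Times_iff PiE_iff)
    have second: "snd x i \<in> ?I i" if "i \<in> ?J" for i using x that by (simp add: mem_Times_iff PiE_iff)
    have "(merge_vec k x :: real ^ 'm) $ m \<in> {l $ m<..<u $ m}" for m
      using cart_index_less[of m] first[of "cart_index m"] second[of "cart_index m"]
      by (cases "cart_index m < k") (simp_all add: merge_vec_def)
    then show "x \<in> merge_vec k -` box l u \<inter> space ?N"
      using x by (simp add: mem_box_cart space_pair_measure space_PiM mem_Times_iff PiE_iff)
  qed
  then have "emeasure (distr ?N borel (merge_vec k)) (box l u) = emeasure ?N (Pi\<^sub>E {..<k} ?I \<times> Pi\<^sub>E ?J ?I)"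
    by (subst emeasure_distr[OF measurable_merge_vec]) auto
  also have "\<dots> = emeasure (lborel_pow {..<k}) (Pi\<^sub>E {..<k} ?I) * emeasure (lborel_pow ?J) (Pi\<^sub>E ?J ?I)"
    by (intro sigma_finite_measure.emeasure_pair_measure_Times[OF sigma_finite_lborel_pow] sets_PiM_I_finite) auto
  also have "\<dots> = (\<Prod>i<k. ennreal (u $ crd i - l $ crd i)) * (\<Prod>i\<in>?J. ennreal (u $ crd i - l $ crd i))"
    using le by (simp add: emeasure_PiM)
  also have "\<dots> = (\<Prod>i<CARD('m). ennreal (u $ crd i - l $ crd i))"
    using k by (subst prod.union_disjoint[symmetric]) (auto intro!: prod.cong)
  also have "\<dots> = (\<Prod>m\<in>UNIV. ennreal (u $ m - l $ m))"
    using prod_cart_index[where h = "\<lambda>i. ennreal (u $ crd i - l $ crd i)", where 'm = 'm] by simp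
  also have "\<dots> = ennreal (\<Prod>b\<in>Basis. (u - l) \<bullet> b)"
    using le by (simp add: prod_Basis_vec prod_ennreal inner_axis)
  finally show "emeasure (distr ?N borel (merge_vec k)) (box l u) = ennreal (\<Prod>b\<in>Basis. (u - l) \<bullet> b)" .
qed simp

text \<open>The integrand is constant in the surplus coordinates, and each of them contributes the
  length 2 of its interval.\<close>

lemma integral_unit_box:
  fixes f :: "(nat \<Rightarrow> real) \<Rightarrow> real"
  assumes k: "k \<le> CARD('m::finite)" and f: "continuous_on (cube k) f"
  shows "integral (unit_box :: (real ^ 'm) set) (\<lambda>x. f (cube_point k x))
    = 2 ^ (CARD('m) - k) * (LINT t:cube k|lborel_pow {..<k}. f t)"
proof -
  let ?J = "{k..<CARD('m)}"
  let ?P = "lborel_pow {..<k}" and ?Q = "lborel_pow ?J"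
  let ?C = "?J \<rightarrow>\<^sub>E {-1..1::real}"
  let ?g = "\<lambda>x :: real ^ 'm. indicator unit_box x *\<^sub>R f (cube_point k x)"
  interpret P: sigma_finite_measure ?P by (rule sigma_finite_lborel_pow) simp
  interpret Q: sigma_finite_measure ?Q by (rule sigma_finite_lborel_pow) simp
  interpret pair_sigma_finite ?P ?Q ..
  have cont: "continuous_on (unit_box :: (real ^ 'm) set) (\<lambda>x. f (cube_point k x))"
    by (rule continuous_on_comp_cube_point[OF f])
  have g: "?g \<in> borel_measurable borel"
    by (rule borel_measurable_continuous_on_indicator[OF _ cont]) (simp add: unit_box_cbox)
  have int: "integrable lborel ?g"
    using borel_integrable_compact[OF _ cont] by (simp add: unit_box_cbox)
  have dom: "x \<in> space (?P \<Otimes>\<^sub>M ?Q) \<Longrightarrow>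
      ?g (merge_vec k x) = (indicator (cube k) (fst x) *\<^sub>R f (fst x)) * indicator ?C (snd x)" for x
  proof -
    assume x: "x \<in> space (?P \<Otimes>\<^sub>M ?Q)"
    let ?v = "merge_vec k x :: real ^ 'm"
    have "?v \<in> unit_box \<longleftrightarrow> (\<forall>i<CARD('m). ?v $ crd i \<in> {-1..1})"
      unfolding unit_box_def mem_Collect_eq by (rule all_crd)
    also have "\<dots> \<longleftrightarrow> (\<forall>i<CARD('m). (if i < k then fst x i else snd x i) \<in> {-1..1})"
      by (simp add: merge_vec_def index_crd)
    also have "\<dots> \<longleftrightarrow> fst x \<in> cube k \<and> snd x \<in> ?C"
      using x k by (auto simp: space_pair_measure space_PiM mem_Times_iff PiE_iff cube_def not_less)
    finally have "?v \<in> unit_box \<longleftrightarrow> fst x \<in> cube k \<and> snd x \<in> ?C" .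
    moreover have "cube_point k ?v = fst x"
      using x k by (auto simp: cube_point_def merge_vec_def index_crd fun_eq_iff space_pair_measure
          space_PiM mem_Times_iff PiE_iff extensional_def)
    ultimately show ?thesis by (simp add: indicator_def)
  qed
  have "integral (unit_box :: (real ^ 'm) set) (\<lambda>x. f (cube_point k x)) = integral\<^sup>L lborel ?g"
    using set_borel_integral_eq_integral(2)[of "unit_box :: (real ^ 'm) set" "\<lambda>x. f (cube_point k x)"] int
    by (simp add: set_integrable_def set_lebesgue_integral_def)
  also have "\<dots> = integral\<^sup>L (?P \<Otimes>\<^sub>M ?Q) (\<lambda>x. ?g (merge_vec k x))"
    unfolding distr_merge_vec[OF k] by (rule integral_distr[OF measurable_merge_vec g])
  also have "\<dots> = integral\<^sup>L (?P \<Otimes>\<^sub>M ?Q) (\<lambda>x. (indicator (cube k) (fst x) *\<^sub>R f (fst x)) * indicator ?C (snd x))"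
    by (rule Bochner_Integration.integral_cong[OF refl dom])
  also have "\<dots> = (\<integral>s. (\<integral>t. (indicator (cube k) s *\<^sub>R f s) * indicator ?C t \<partial>?Q) \<partial>?P)"
  proof -
    have "integrable (distr (?P \<Otimes>\<^sub>M ?Q) borel (merge_vec k)) ?g"
      using int unfolding distr_merge_vec[OF k] .
    then have "integrable (?P \<Otimes>\<^sub>M ?Q) (\<lambda>x. ?g (merge_vec k x))"
      by (simp only: integrable_distr_eq[OF measurable_merge_vec g])
    also have "?this \<longleftrightarrow> integrable (?P \<Otimes>\<^sub>M ?Q)
        (\<lambda>x. (indicator (cube k) (fst x) *\<^sub>R f (fst x)) * indicator ?C (snd x))"
      by (rule Bochner_Integration.integrable_cong[OF refl dom])
    finally show ?thesis using integral_fst'[of "\<lambda>x. (indicator (cube k) (fst x) *\<^sub>R f (fst x)) * indicator ?C (snd x)"] by simp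
  qed
  also have "\<dots> = (\<integral>s. (indicator (cube k) s *\<^sub>R f s) * measure ?Q ?C \<partial>?P)"
    by (simp add: sets_PiM_I_finite)
  also have "measure ?Q ?C = 2 ^ (CARD('m) - k)"
  proof -
    have "emeasure ?Q ?C = ennreal (2 ^ (CARD('m) - k))"
      by (simp add: emeasure_cube flip: ennreal_power)
    then show ?thesis by (simp add: measure_def)
  qed
  finally show ?thesis by (simp add: set_lebesgue_integral_def mult.commute)
qed

section \<open>Block determinants and substitution on the cube\<close>

lemma alternating_form_padded_det:
  assumes k: "k \<le> CARD('m::finite)"
  shows "alternating_form k (\<lambda>v. det (\<chi> m :: 'm. if cart_index m < k then v (cart_index m) else axis m 1))"
  unfolding alternating_form_def
proof (intro conjI allI impI)
  fix v w :: "nat \<Rightarrow> real ^ 'm" assume "\<forall>i<k. v i = w i"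
  then show "det (\<chi> m :: 'm. if cart_index m < k then v (cart_index m) else axis m 1)
      = det (\<chi> m :: 'm. if cart_index m < k then w (cart_index m) else axis m 1)"
    by (intro arg_cong[where f = det]) (simp add: vec_eq_iff)
next
  fix i and v :: "nat \<Rightarrow> real ^ 'm" assume i: "i < k"
  define c where "c m = (if cart_index m < k then v (cart_index m) else axis m 1)" for m :: 'm
  have "(\<chi> m :: 'm. if cart_index m < k then (v(i := u)) (cart_index m) else axis m 1)
      = (\<chi> m. if m = crd i then u else c m)" for u
    using i k by (auto simp: vec_eq_iff c_def index_crd)
  moreover have "linear (\<lambda>u. det (\<chi> m. if m = crd i then u else c m))"
  proof (rule linearI)
    fix x y :: "real ^ 'm" and r :: real
    show "det (\<chi> m. if m = crd i then x + y else c m)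
        = det (\<chi> m. if m = crd i then x else c m) + det (\<chi> m. if m = crd i then y else c m)"
      by (rule det_row_add)
    show "det (\<chi> m. if m = crd i then r *\<^sub>R x else c m) = r *\<^sub>R det (\<chi> m. if m = crd i then x else c m)"
      using det_row_mul[of "crd i" r "\<lambda>_. x" c] unfolding scalar_mult_eq_scaleR real_scaleR_def .
  qed
  ultimately show "linear (\<lambda>u. det (\<chi> m :: 'm. if cart_index m < k then (v(i := u)) (cart_index m) else axis m 1))"
    by simp
next
  fix i j and v :: "nat \<Rightarrow> real ^ 'm" assume ij: "i < k" "j < k" "i \<noteq> j \<and> v i = v j"
  have index: "cart_index (crd i :: 'm) = i" "cart_index (crd j :: 'm) = j"
    using ij k by (simp_all add: index_crd)
  show "det (\<chi> m :: 'm. if cart_index m < k then v (cart_index m) else axis m 1) = 0"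
  proof (rule det_identical_rows)
    show "(crd i :: 'm) \<noteq> crd j" using ij index by metis
  qed (simp add: row_def index ij)
qed

text \<open>The determinant of a block matrix with blocks \<open>A\<close> and the identity. As an
  alternating form in its first \<open>k\<close> rows it falls under
  \<open>alternating_form_det\<close>, which yields the sum over permutations of
  \<open>{..<k}\<close> directly; the remaining factor is the determinant of the identity.\<close>

lemma det_padded:
  assumes k: "k \<le> CARD('m::finite)"
  shows "det (\<chi> m :: 'm. if cart_index m < k then \<Sum>l<k. A (cart_index m) l *\<^sub>R axis (crd l) 1 else axis m 1)
    = (\<Sum>p | p permutes {..<k}. of_int (sign p) * (\<Prod>j<k. A j (p j)))"
proof -
  have "(\<chi> m :: 'm. if cart_index m < k then axis (crd (cart_index m)) 1 else axis m 1) = (mat 1 :: real ^ 'm ^ 'm)"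
    by (simp add: vec_eq_iff mat_def axis_def)
  then show ?thesis
    using alternating_form_det[OF alternating_form_padded_det[OF k], of A "\<lambda>l. axis (crd l) 1"] by simp
qed

lemma continuous_on_cube_map:
  assumes "\<theta> \<in> cube k \<rightarrow> cube k" "\<And>i. i < k \<Longrightarrow> continuous_on (cube k) (\<lambda>t. \<theta> t i)"
  shows "continuous_on (cube k) \<theta>"
proof (rule continuous_on_coordinatewise_then_product)
  fix i
  show "continuous_on (cube k) (\<lambda>t. \<theta> t i)"
  proof (cases "i < k")
    case False
    have "undefined = \<theta> t i" if "t \<in> cube k" for t
      using False funcset_mem[OF assms(1) that] by (simp add: cube_def PiE_iff extensional_def)
    then show ?thesis by (rule continuous_on_eq[OF continuous_on_const])
  qed (rule assms(2))
qed

lemma continuous_on_jacobian: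
  assumes "\<And>i. i < k \<Longrightarrow> cube_Cr (Suc 0) k (cube k) (\<lambda>t. \<theta> t i)"
  shows "continuous_on (cube k) (jacobian k \<theta>)"
  unfolding jacobian_def[abs_def]
proof (intro continuous_on_sum continuous_on_mult continuous_on_const continuous_on_prod)
  fix p i assume "p \<in> {p. p permutes {..<k}}" "i \<in> {..<k}"
  then have "i < k" "p i < k" using permutes_in_image[of p "{..<k}" i] by auto
  from cube_CrD(3)[OF assms[OF this(1)] this(2)]
  show "continuous_on (cube k) (\<lambda>t. partial (p i) (\<lambda>t. \<theta> t i) t)" by simp
qed

text \<open>Extending \<open>\<theta>\<close> by the identity on the surplus coordinates gives a
  bijection \<open>G \<theta>\<close> of the box, with inverse \<open>G \<theta>'\<close>, whose
  derivative has the block determinant \<open>jacobian k \<theta>\<close>. The powers of 2 from the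
  padding cancel.\<close>

lemma cube_change_of_variables:
  fixes F :: "(nat \<Rightarrow> real) \<Rightarrow> real"
  assumes k: "k \<le> CARD('m::{finite,wellorder})" and F: "continuous_on (cube k) F"
    and \<theta>: "\<theta> \<in> cube k \<rightarrow> cube k" and \<theta>': "\<theta>' \<in> cube k \<rightarrow> cube k"
    and inv: "\<And>t. t \<in> cube k \<Longrightarrow> \<theta>' (\<theta> t) = t" "\<And>t. t \<in> cube k \<Longrightarrow> \<theta> (\<theta>' t) = t"
    and smooth: "\<And>i. i < k \<Longrightarrow> cube_Cr (Suc 0) k (cube k) (\<lambda>t. \<theta> t i)"
  shows "(LINT t:cube k|lborel_pow {..<k}. \<bar>jacobian k \<theta> t\<bar> * F (\<theta> t)) = (LINT t:cube k|lborel_pow {..<k}. F t)"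
proof -
  define G :: "((nat \<Rightarrow> real) \<Rightarrow> nat \<Rightarrow> real) \<Rightarrow> real ^ 'm::_ \<Rightarrow> real ^ 'm::_"
    where "G \<theta> x = (\<chi> m. if cart_index m < k then \<theta> (cube_point k x) (cart_index m) else x $ m)" for \<theta> x
  define G' :: "real ^ 'm::_ \<Rightarrow> real ^ 'm::_ \<Rightarrow> real ^ 'm::_"
    where "G' x h = (\<chi> m. if cart_index m < k
      then \<Sum>l<k. h $ crd l *\<^sub>R partial l (\<lambda>t. \<theta> t (cart_index m)) (cube_point k x) else h $ m)" for x h
  have G_box: "G \<eta> x \<in> unit_box" if "\<eta> \<in> cube k \<rightarrow> cube k" "x \<in> unit_box" for \<eta> x
    using cube_bounds[OF funcset_mem[OF that(1) cube_point_cube[OF that(2)]]] that(2)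
    by (simp add: unit_box_def G_def)
  have G_point: "cube_point k (G \<eta> x) = \<eta> (cube_point k x)" if "\<eta> \<in> cube k \<rightarrow> cube k" "x \<in> unit_box" for \<eta> x
  proof
    fix i
    show "cube_point k (G \<eta> x) i = \<eta> (cube_point k x) i"
      using funcset_mem[OF that(1) cube_point_cube[OF that(2)]] k
      by (cases "i < k") (simp_all add: cube_point_def G_def index_crd cube_def PiE_iff extensional_def)
  qed
  have G_inv: "G \<zeta> (G \<eta> x) = x"
    if "\<eta> \<in> cube k \<rightarrow> cube k" "\<And>t. t \<in> cube k \<Longrightarrow> \<zeta> (\<eta> t) = t" "x \<in> unit_box" for \<zeta> \<eta> x
  proof -
    have "\<zeta> (cube_point k (G \<eta> x)) = cube_point k x"
      using that by (simp add: G_point cube_point_cube)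
    then show ?thesis
      unfolding G_def[of \<zeta>] by (simp add: vec_eq_iff cube_point_def) (simp add: G_def)
  qed
  have inj: "inj_on (G \<theta>) unit_box"
    by (rule inj_on_inverseI[of _ "G \<theta>'"]) (rule G_inv[OF \<theta> inv(1)])
  have img: "G \<theta> ` unit_box = unit_box"
  proof
    show "unit_box \<subseteq> G \<theta> ` unit_box"
      using G_inv[OF \<theta>' inv(2)] G_box[OF \<theta>'] by (metis image_eqI subsetI)
  qed (use G_box[OF \<theta>] in blast)
  have deriv: "(G \<theta> has_derivative G' x) (at x within unit_box)" if x: "x \<in> unit_box" for x
  proof (subst has_derivative_componentwise_within, rule ballI)
    fix b :: "real ^ 'm::_" assume "b \<in> Basis"
    then obtain m where b: "b = axis m 1" by (auto simp: Basis_vec_def)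
    show "((\<lambda>x. G \<theta> x \<bullet> b) has_derivative (\<lambda>h. G' x h \<bullet> b)) (at x within unit_box)"
    proof (cases "cart_index m < k")
      case True
      have "((\<lambda>x. \<theta> (cube_point k x) (cart_index m)) has_derivative
          (\<lambda>h. \<Sum>l<k. h $ crd l *\<^sub>R partial l (\<lambda>t. \<theta> t (cart_index m)) (cube_point k x))) (at x within unit_box)"
        by (rule cube_has_derivative[OF k _ smooth[OF True] x cube_point_cube[OF x]]) simp
      then show ?thesis using True by (simp add: b inner_axis G_def G'_def)
    next
      case False
      then show ?thesis
        by (simp add: b inner_axis G_def G'_def bounded_linear_imp_has_derivative bounded_linear_vec_nth)
    qed
  qed
  have det: "det (matrix (G' x)) = jacobian k \<theta> (cube_point k x)" for x
  proof -
    have "matrix (G' x) = (\<chi> m. if cart_index m < k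
        then \<Sum>l<k. partial l (\<lambda>t. \<theta> t (cart_index m)) (cube_point k x) *\<^sub>R axis (crd l) 1 else axis m 1)"
      by (auto simp: vec_eq_iff matrix_def G'_def axis_def intro!: sum.cong)
    then show ?thesis
      using det_padded[OF k, of "\<lambda>j l. partial l (\<lambda>t. \<theta> t j) (cube_point k x)"]
      by (simp add: jacobian_def)
  qed
  let ?B = "unit_box :: (real ^ 'm::_) set"
  have leb: "?B \<in> sets lebesgue" by (simp add: unit_box_cbox)
  have "continuous_on ?B (\<lambda>x. F (cube_point k x))"
    by (rule continuous_on_comp_cube_point[OF F])
  \<comment> \<open>Integrands become vectors of length 1 to fit the change of variables theorem for
    vector-valued functions.\<close>
  then have "(\<lambda>x. vec (F (cube_point k x)) :: real ^ 1) absolutely_integrable_on ?B"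
    unfolding absolutely_integrable_on_1_iff unit_box_cbox
    by (simp add: absolutely_integrable_continuous)
  then have "integral ?B (\<lambda>x. vec (F (cube_point k x)) :: real ^ 1)
      = integral ?B (\<lambda>x. \<bar>det (matrix (G' x))\<bar> *\<^sub>R vec (F (cube_point k (G \<theta> x))))"
    using integral_change_of_variables[OF leb deriv inj, of "\<lambda>x. vec (F (cube_point k x)) :: real ^ 1"]
    unfolding img by blast
  then have "integral ?B (\<lambda>x. F (cube_point k x))
      = integral ?B (\<lambda>x. \<bar>det (matrix (G' x))\<bar> * F (cube_point k (G \<theta> x)))"
    by (simp add: integral_on_1_eq)
  also have "\<dots> = integral ?B (\<lambda>x. \<bar>jacobian k \<theta> (cube_point k x)\<bar> * F (\<theta> (cube_point k x)))"
    by (rule integral_cong) (simp add: det G_point[OF \<theta>])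
  finally have eq: "integral ?B (\<lambda>x. \<bar>jacobian k \<theta> (cube_point k x)\<bar> * F (\<theta> (cube_point k x)))
      = integral ?B (\<lambda>x. F (cube_point k x))" ..
  have cont: "continuous_on (cube k) (\<lambda>t. \<bar>jacobian k \<theta> t\<bar> * F (\<theta> t))"
    using \<theta> by (intro continuous_on_mult continuous_on_rabs continuous_on_jacobian smooth
        continuous_on_compose2[OF F continuous_on_cube_map] cube_CrD(1)[OF smooth]) auto
  show ?thesis
    using eq unfolding integral_unit_box[OF k F]
      integral_unit_box[OF k cont] by simp
qed

subsection \<open>Stokes' theorem for singular cubes\<close>

lemma cube_face_ins: "cube_face (Suc k) i \<alpha> \<tau> = restrict (\<lambda>t. \<tau> (ins i \<alpha> t)) (cube k)"
  by (simp add: cube_face_def ins_def)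

lemma ins_update: "(ins i \<alpha> t)(skip i j := s) = ins i \<alpha> (t(j := s))"
  by (auto simp: ins_def skip_def fun_eq_iff)

lemma ins_update_self: "(ins i \<alpha> t)(i := s) = ins i s t"
  by (auto simp: ins_def)

text \<open>Velocity \<open>j\<close> of the face is velocity \<open>skip i j\<close> of the cube at
  the embedded point. Both sides choose the same chart, because they look at the same point of the
  manifold.\<close>

lemma cube_pullback_face:
  assumes M: "oriented_manifold M" and a: "a \<in> forms M p" and \<tau>: "singular_cube M (Suc p) \<tau>"
    and i: "i \<le> p" and \<alpha>: "\<alpha> \<in> {-1..1}" and t: "t \<in> cube p"
  shows "cube_pullback M a (cube_face (Suc p) i \<alpha> \<tau>) t = pullback_coeff M a \<tau> (skip i) (ins i \<alpha> t)"
proof -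
  interpret cube_form M a p "Suc p" \<tau> using M a \<tau> by unfold_locales
  let ?F = "cube_face (Suc p) i \<alpha> \<tau>"
  have F: "?F t = \<tau> (ins i \<alpha> t)" if "t \<in> cube p" for t using that by (simp add: cube_face_ins)
  have cube: "ins i \<alpha> t \<in> cube (Suc p)"
    using ins_cube[OF i] t \<alpha> by (simp add: cube_def PiE_iff)
  define c where "c = some_chart M (\<tau> (ins i \<alpha> t))"
  have c: "c \<in> atlas M" "ins i \<alpha> t \<in> dom c" unfolding c_def using some_chart[OF cube] by auto
  have "partial j (\<lambda>t. snd c (?F t)) t = partial (skip i j) (coord c) (ins i \<alpha> t)" if j: "j < p" for j
  proof (rule partial_eqI)
    show tj: "t j \<in> {-1..1}" by (rule cube_bounds[OF t j])
    have "skip i j < Suc p" using j by (simp add: skip_def)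
    from has_velocity[OF c this]
    have "((\<lambda>s. coord c (ins i \<alpha> (t(j := s)))) has_vector_derivative partial (skip i j) (coord c) (ins i \<alpha> t))
        (at (t j) within {-1..1})"
      by (simp only: ins_update ins_skip)
    then show "((\<lambda>s. snd c (?F (t(j := s)))) has_vector_derivative partial (skip i j) (coord c) (ins i \<alpha> t))
        (at (t j) within {-1..1})"
      by (rule has_vector_derivative_transform[OF tj, rotated]) (simp add: F cube_update[OF t j])
  qed
  then have "a c (coord c (ins i \<alpha> t)) (\<lambda>j. partial j (\<lambda>t. snd c (?F t)) t)
      = a c (coord c (ins i \<alpha> t)) (\<lambda>j. partial (skip i j) (coord c) (ins i \<alpha> t))"
    by (rule alternating_formD(1)[OF formsD(1)[OF a c(1) coord_codom[OF c(2)]]])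
  then show ?thesis
    by (simp add: cube_pullback_coeff pullback_coeff_def Let_def F[OF t] c_def)
qed

lemma continuous_on_ins:
  "continuous_on S (\<lambda>s. ins i s t)" "continuous_on T (ins i s)"
proof -
  show "continuous_on S (\<lambda>s. ins i s t)"
    unfolding ins_def
  proof (rule continuous_on_coordinatewise_then_product)
    show "continuous_on S (\<lambda>s. if j < i then t j else if j = i then s else t (j - 1))" for j
      by (cases "j < i"; cases "j = i") (simp_all add: continuous_on_const continuous_on_id)
  qed
  show "continuous_on T (ins i s)"
    unfolding ins_def[abs_def]
  proof (rule continuous_on_coordinatewise_then_product)
    show "continuous_on T (\<lambda>t. if j < i then t j else if j = i then s else t (j - 1))" for j
      using continuous_on_subset[OF continuous_on_product_coordinates]
      by (cases "j < i"; cases "j = i") (simp_all add: continuous_on_const)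
  qed
qed

text \<open>The sign \<open>(-1) ^ i\<close> comes from the exterior derivative and the difference
  of opposite faces from the fundamental theorem of calculus; together they are the signs of
  \<open>chain_bd\<close>. The bound on \<open>p\<close> lets \<open>real ^ 'n\<close> itself serve
  as the padding space.\<close>

theorem stokes_cube:
  fixes M :: "('a, 'n::finite) manifold"
  assumes M: "oriented_manifold M" and a: "a \<in> forms M p" and \<tau>: "singular_cube M (Suc p) \<tau>"
    and p: "Suc p \<le> CARD('n)"
  shows "cell_integral M (ext_deriv M p a) (Suc p, \<tau>) =
    (\<Sum>i\<le>p. (-1) ^ i * (cell_integral M a (p, cube_face (Suc p) i 1 \<tau>)
      - cell_integral M a (p, cube_face (Suc p) i (-1) \<tau>)))"
proof -
  interpret cube_form M a p "Suc p" \<tau> using M a \<tau> by unfold_locales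
  define W where "W i = pullback_coeff M a \<tau> (skip i)" for i
  have skip: "skip i j < Suc p" if "j < p" for i j using that by (simp add: skip_def)
  have cW: "continuous_on (cube (Suc p)) (W i)" for i
    unfolding W_def by (rule continuous_on_coeff) (rule skip)
  have cP: "continuous_on (cube (Suc p)) (partial i (W i))" if "i \<le> p" for i
    unfolding W_def using that by (intro continuous_on_partial_coeff skip) auto
  have ins: "ins i s t \<in> cube (Suc p)" if "i \<le> p" "t \<in> cube p" "s \<in> {-1..1}" for i s t
    using ins_cube[OF that(1)] that(2,3) by (simp add: cube_def PiE_iff)
  have face_int: "set_integrable (lborel_pow {..<p}) (cube p) (\<lambda>t. W i (ins i \<alpha> t))"
    if "i \<le> p" "\<alpha> \<in> {-1..1}" for i \<alpha>
    using p that by (intro integrable_cube[where 'm = 'n] continuous_on_compose2[OF cW continuous_on_ins(2)])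
      (auto intro: ins)
  have line: "(LINT t:cube (Suc p)|lborel_pow {..<Suc p}. partial i (W i) t)
      = cell_integral M a (p, cube_face (Suc p) i 1 \<tau>) - cell_integral M a (p, cube_face (Suc p) i (-1) \<tau>)"
    if i: "i \<le> p" for i
  proof -
    have "(\<integral>s. indicator {-1..1} s *\<^sub>R partial i (W i) (ins i s t) \<partial>lborel) = W i (ins i 1 t) - W i (ins i (-1) t)"
      if t: "t \<in> cube p" for t
    proof (rule integral_FTC_Icc)
      fix s :: real assume "-1 \<le> s" "s \<le> 1"
      then have "ins i s t \<in> cube (Suc p)" by (intro ins[OF i t]) simp
      from coeff_has_partial[where \<sigma> = "skip i" and i = i, OF this, folded W_def] skip
      have "((\<lambda>s'. W i ((ins i s t)(i := s'))) has_vector_derivative partial i (W i) (ins i s t))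
          (at (ins i s t i) within {-1..1})"
        using i by simp
      moreover have "ins i s t i = s" by (simp add: ins_def)
      ultimately show "((\<lambda>s. W i (ins i s t)) has_vector_derivative partial i (W i) (ins i s t)) (at s within {-1..1})"
        by (simp only: ins_update_self)
    next
      show "continuous_on {-1..1} (\<lambda>s. partial i (W i) (ins i s t))"
        by (rule continuous_on_compose2[OF cP[OF i] continuous_on_ins(1)]) (auto intro: ins[OF i t])
    qed simp
    then have "(LINT t:cube (Suc p)|lborel_pow {..<Suc p}. partial i (W i) t)
        = (LINT t:cube p|lborel_pow {..<p}. W i (ins i 1 t) - W i (ins i (-1) t))"
      unfolding cube_integral_ins[OF p cP[OF i] i]
      by (intro set_lebesgue_integral_cong cube_sets) simp
    also have "\<dots> = (LINT t:cube p|lborel_pow {..<p}. W i (ins i 1 t))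
        - (LINT t:cube p|lborel_pow {..<p}. W i (ins i (-1) t))"
      using i by (intro set_integral_diff face_int) auto
    finally have diff: "(LINT t:cube (Suc p)|lborel_pow {..<Suc p}. partial i (W i) t)
        = (LINT t:cube p|lborel_pow {..<p}. W i (ins i 1 t)) - (LINT t:cube p|lborel_pow {..<p}. W i (ins i (-1) t))" .
    have "(LINT t:cube p|lborel_pow {..<p}. W i (ins i \<alpha> t)) = cell_integral M a (p, cube_face (Suc p) i \<alpha> \<tau>)"
      if "\<alpha> \<in> {-1..1}" for \<alpha>
      unfolding cell_integral_def fst_conv snd_conv W_def using cube_pullback_face[OF M a \<tau> i that]
      by (intro set_lebesgue_integral_cong cube_sets) simp
    then show ?thesis unfolding diff by simp
  qed
  have int: "set_integrable (lborel_pow {..<Suc p}) (cube (Suc p)) (partial i (W i))" if "i \<le> p" for i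
    by (rule integrable_cube[OF p cP[OF that]])
  have "cell_integral M (ext_deriv M p a) (Suc p, \<tau>)
      = (LINT t:cube (Suc p)|lborel_pow {..<Suc p}. \<Sum>i\<le>p. (-1) ^ i * partial i (W i) t)"
    unfolding cell_integral_def fst_conv snd_conv W_def
    by (intro set_lebesgue_integral_cong cube_sets) (simp add: cube_pullback_ext_deriv[OF M a \<tau>])
  also have "\<dots> = (\<integral>t. (\<Sum>i\<le>p. (-1) ^ i * (indicator (cube (Suc p)) t *\<^sub>R partial i (W i) t)) \<partial>lborel_pow {..<Suc p})"
    by (simp add: set_lebesgue_integral_def sum_distrib_left mult.left_commute)
  also have "\<dots> = (\<Sum>i\<le>p. (-1) ^ i * (LINT t:cube (Suc p)|lborel_pow {..<Suc p}. partial i (W i) t))"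
    unfolding set_lebesgue_integral_def
    by (subst Bochner_Integration.integral_sum)
       (use int in \<open>auto simp: set_integrable_def intro!: sum.cong\<close>)
  finally show ?thesis by (simp add: line)
qed

subsection \<open>Invariance under reparametrization\<close>

text \<open>Reindexing by inverse permutations. It reconciles \<open>jacobian\<close>, where the
  permutation selects the differentiation variable, with \<open>alternating_form_det\<close>, where
  it selects the component.\<close>

lemma det_sum_transpose:
  fixes A :: "nat \<Rightarrow> nat \<Rightarrow> real"
  shows "(\<Sum>p | p permutes {..<k}. of_int (sign p) * (\<Prod>j<k. A (p j) j))
    = (\<Sum>p | p permutes {..<k}. of_int (sign p) * (\<Prod>j<k. A j (p j)))"
proof -
  have "of_int (sign (inv p)) * (\<Prod>j<k. A j (inv p j)) = of_int (sign p) * (\<Prod>j<k. A (p j) j)"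
    if p: "p permutes {..<k}" for p
  proof -
    have "permutation p" using p permutation_permutes by blast
    moreover have "(\<Prod>j<k. A j (inv p j)) = (\<Prod>j<k. A (p j) j)"
      using prod.permute[OF p, of "\<lambda>j. A j (inv p j)"] permutes_inverses(2)[OF p] by (simp add: o_def)
    ultimately show ?thesis by (simp add: sign_inverse)
  qed
  then show ?thesis
    by (subst (2) sum_permutations_inverse) (auto intro!: sum.cong)
qed

text \<open>By the chain rule the velocities of \<open>\<tau>\<close> are combinations of those of
  \<open>\<sigma>\<close>, with the partial derivatives of \<open>\<theta>\<close> as coefficients;
  the alternating form turns these into a determinant.\<close>

lemma cube_pullback_reparam:
  fixes M :: "('a, 'n::finite) manifold"
  assumes M: "oriented_manifold M" and a: "a \<in> forms M p" and \<sigma>: "singular_cube M p \<sigma>"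
    and p: "p \<le> CARD('n)" and \<theta>: "\<theta> \<in> cube p \<rightarrow> cube p"
    and smooth: "\<And>i. i < p \<Longrightarrow> cube_Cr (Suc 0) p (cube p) (\<lambda>t. \<theta> t i)"
    and comp: "\<And>t. t \<in> cube p \<Longrightarrow> \<tau> t = \<sigma> (\<theta> t)" and t: "t \<in> cube p"
  shows "cube_pullback M a \<tau> t = jacobian p \<theta> t * cube_pullback M a \<sigma> (\<theta> t)"
proof -
  interpret cube_form M a p p \<sigma> using M a \<sigma> by unfold_locales
  have \<theta>t: "\<theta> t \<in> cube p" using \<theta> t by auto
  define c where "c = some_chart M (\<sigma> (\<theta> t))"
  have c: "c \<in> atlas M" "\<theta> t \<in> dom c" unfolding c_def using some_chart[OF \<theta>t] by auto
  note alt = formsD(1)[OF a c(1) coord_codom[OF c(2)]]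
  define A where "A j l = partial j (\<lambda>t. \<theta> t l) t" for j l
  have "partial j (\<lambda>t. snd c (\<tau> t)) t = (\<Sum>l<p. A j l *\<^sub>R velocity c (\<theta> t) l)" if j: "j < p" for j
  proof (rule partial_eqI)
    show tj: "t j \<in> {-1..1}" by (rule cube_bounds[OF t j])
    have upd: "t(j := s) \<in> cube p" if "s \<in> {-1..1}" for s by (rule cube_update[OF t j that])
    have "((\<lambda>s. \<theta> (t(j := s)) l) has_vector_derivative A j l) (at (t j) within {-1..1})" if "l < p" for l
      unfolding A_def by (rule cube_CrD(4)[OF smooth[OF that] j t])
    then have "((\<lambda>s. coord c (\<theta> (t(j := s)))) has_vector_derivative
        (\<Sum>l<p. A j l *\<^sub>R velocity c (\<theta> (t(j := t j))) l)) (at (t j) within {-1..1})"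
      using \<theta> upd tj c
      by (intro has_vector_derivative_cube_compose[OF p open_dom[OF c(1)] coord_Cr[OF c(1)]]) auto
    then have "((\<lambda>s. coord c (\<theta> (t(j := s)))) has_vector_derivative
        (\<Sum>l<p. A j l *\<^sub>R velocity c (\<theta> t) l)) (at (t j) within {-1..1})"
      unfolding fun_upd_triv .
    then show "((\<lambda>s. snd c (\<tau> (t(j := s)))) has_vector_derivative
        (\<Sum>l<p. A j l *\<^sub>R velocity c (\<theta> t) l)) (at (t j) within {-1..1})"
      by (rule has_vector_derivative_transform[OF tj, rotated]) (simp only: comp[OF upd])
  qed
  then have "a c (coord c (\<theta> t)) (\<lambda>j. partial j (\<lambda>t. snd c (\<tau> t)) t)
      = a c (coord c (\<theta> t)) (\<lambda>j. \<Sum>l<p. A j l *\<^sub>R velocity c (\<theta> t) l)"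
    by (rule alternating_formD(1)[OF alt])
  also have "\<dots> = (\<Sum>q | q permutes {..<p}. of_int (sign q) * (\<Prod>j<p. A j (q j)))
      * a c (coord c (\<theta> t)) (velocity c (\<theta> t))"
    by (rule alternating_form_det[OF alt])
  also have "(\<Sum>q | q permutes {..<p}. of_int (sign q) * (\<Prod>j<p. A j (q j))) = jacobian p \<theta> t"
    unfolding jacobian_def A_def[symmetric] by (rule det_sum_transpose[symmetric])
  finally show ?thesis
    using comp[OF t] by (simp add: cube_pullback_coeff pullback_coeff_def Let_def c_def)
qed

text \<open>Applied with a face as \<open>\<tau>\<close> and the cell that it parametrizes as
  \<open>\<sigma>\<close>.\<close>

lemma cell_integral_reparam:
  fixes M :: "('a, 'n::finite) manifold"
  assumes M: "oriented_manifold M" and a: "a \<in> forms M p" and \<sigma>: "singular_cube M p \<sigma>"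
    and p: "p \<le> CARD('n)" and rep: "reparam p s \<tau> \<sigma>"
  shows "cell_integral M a (p, \<tau>) = of_int s * cell_integral M a (p, \<sigma>)"
proof -
  interpret cube_form M a p p \<sigma> using M a \<sigma> by unfold_locales
  from rep[unfolded reparam_def, THEN conjunct2] obtain \<theta> \<theta>'
    where \<theta>: "\<theta> \<in> cube p \<rightarrow> cube p" "\<theta>' \<in> cube p \<rightarrow> cube p"
    and inv_all: "\<forall>t\<in>cube p. \<theta>' (\<theta> t) = t \<and> \<theta> (\<theta>' t) = t"
    and smooth_all: "\<forall>i<p. cube_smooth p (cube p) (\<lambda>t. \<theta> t i) \<and> cube_smooth p (cube p) (\<lambda>t. \<theta>' t i)"
    and sgn: "\<forall>t\<in>cube p. sgn (jacobian p \<theta> t) = of_int s"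
    and comp: "\<forall>t\<in>cube p. \<tau> t = \<sigma> (\<theta> t)"
    by (elim exE conjE)
  have inv: "\<And>t. t \<in> cube p \<Longrightarrow> \<theta>' (\<theta> t) = t" "\<And>t. t \<in> cube p \<Longrightarrow> \<theta> (\<theta>' t) = t"
    using inv_all by simp_all
  have smooth: "cube_Cr (Suc 0) p (cube p) (\<lambda>t. \<theta> t i)" if "i < p" for i
    using smooth_all that unfolding cube_smooth_def by blast
  have F: "continuous_on (cube p) (cube_pullback M a \<sigma>)"
    unfolding cube_pullback_coeff by (rule continuous_on_coeff) simp
  have "cell_integral M a (p, \<tau>)
      = (LINT t:cube p|lborel_pow {..<p}. of_int s * (\<bar>jacobian p \<theta> t\<bar> * cube_pullback M a \<sigma> (\<theta> t)))"
    unfolding cell_integral_def fst_conv snd_conv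
  proof (intro set_lebesgue_integral_cong cube_sets allI impI)
    fix t assume t: "t \<in> cube p"
    \<comment> \<open>The substitution rule involves the absolute value of the Jacobian. Its sign is
      constant, so \<open>s\<close> can be pulled out.\<close>
    have "jacobian p \<theta> t = of_int s * \<bar>jacobian p \<theta> t\<bar>"
      using sgn_mult_abs[of "jacobian p \<theta> t"] bspec[OF sgn t] by simp
    then show "cube_pullback M a \<tau> t = of_int s * (\<bar>jacobian p \<theta> t\<bar> * cube_pullback M a \<sigma> (\<theta> t))"
      using cube_pullback_reparam[OF M a \<sigma> p \<theta>(1) smooth bspec[OF comp] t] by simp
  qed
  also have "\<dots> = of_int s * (LINT t:cube p|lborel_pow {..<p}. \<bar>jacobian p \<theta> t\<bar> * cube_pullback M a \<sigma> (\<theta> t))"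
    by (rule set_integral_mult_right)
  also have "(LINT t:cube p|lborel_pow {..<p}. \<bar>jacobian p \<theta> t\<bar> * cube_pullback M a \<sigma> (\<theta> t))
      = (LINT t:cube p|lborel_pow {..<p}. cube_pullback M a \<sigma> t)"
    \<comment> \<open>The substitution rule asks for a well-ordered index type.
      \<open>'n bit0\<close> is one for every finite \<open>'n\<close>, with
      \<open>2 * CARD('n)\<close> elements and hence room for \<open>p\<close> coordinates.\<close>
    using p by (intro cube_change_of_variables[where 'm = "'n bit0", OF _ F \<theta> inv smooth]) simp_all
  finally show ?thesis by (simp add: cell_integral_def)
qed

subsection \<open>Stokes' theorem on chains\<close>

text \<open>\<open>reduction\<close> without the cut-off outside the chains of a part, hence
  additive on all chains.\<close>

definition chain_integral :: "('a, 'n::finite) manifold \<Rightarrow> ('a, 'n) form \<Rightarrow> 'a chain \<Rightarrow> real" where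
  "chain_integral M a c =
    (\<Sum>\<sigma>\<in>Poly_Mapping.keys c. of_int (Poly_Mapping.lookup c \<sigma>) * cell_integral M a \<sigma>)"

text \<open>Keys may cancel in a sum of chains; over a common larger index set the missing ones
  merely have coefficient 0.\<close>

lemma chain_integral_superset:
  "finite S \<Longrightarrow> Poly_Mapping.keys c \<subseteq> S \<Longrightarrow>
    chain_integral M a c = (\<Sum>\<sigma>\<in>S. of_int (Poly_Mapping.lookup c \<sigma>) * cell_integral M a \<sigma>)"
  unfolding chain_integral_def by (rule sum.mono_neutral_left) (auto simp: in_keys_iff)

lemma chain_integral_add: "chain_integral M a (b + c) = chain_integral M a b + chain_integral M a c"
proof -
  let ?S = "Poly_Mapping.keys b \<union> Poly_Mapping.keys c"
  have "chain_integral M a x = (\<Sum>\<sigma>\<in>?S. of_int (Poly_Mapping.lookup x \<sigma>) * cell_integral M a \<sigma>)"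
    if "x \<in> {b, c, b + c}" for x
    using that Poly_Mapping.keys_add[of b c] by (intro chain_integral_superset) auto
  then show ?thesis by (simp add: lookup_add distrib_right sum.distrib)
qed

lemma chain_integral_cmul: "chain_integral M a (frag_cmul s c) = of_int s * chain_integral M a c"
  by (subst chain_integral_superset[OF finite_keys keys_cmul])
     (simp add: chain_integral_def sum_distrib_left mult.assoc)

lemma chain_integral_diff: "chain_integral M a (b - c) = chain_integral M a b - chain_integral M a c"
  using chain_integral_add[of M a "b - c" c] by simp

lemma chain_integral_sum: "chain_integral M a (\<Sum>i\<in>S. f i) = (\<Sum>i\<in>S. chain_integral M a (f i))"
proof (induction S rule: infinite_finite_induct)
  case (insert i S)
  then show ?case by (simp add: chain_integral_add)
qed (simp_all add: chain_integral_def)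

lemma chain_integral_of: "chain_integral M a (frag_of \<sigma>) = cell_integral M a \<sigma>"
  by (simp add: chain_integral_def)

lemma cell_complexD:
  fixes M :: "('a, 'n::finite) manifold"
  assumes "cell_complex M D" "(k, \<tau>) \<in> D"
  shows "k \<le> CARD('n)" "singular_cube M k \<tau>"
    and "i < k \<Longrightarrow> \<alpha> \<in> {-1, 1} \<Longrightarrow>
      \<exists>!(\<sigma>, s). (k - 1, \<sigma>) \<in> D \<and> reparam (k - 1) s (cube_face k i \<alpha> \<tau>) \<sigma>"
proof -
  note cell = bspec[OF assms(1)[unfolded cell_complex_def, THEN conjunct2, THEN conjunct1] assms(2),
      unfolded prod.case]
  show "k \<le> CARD('n)" by (rule cell[THEN conjunct1])
  show "singular_cube M k \<tau>" by (rule cell[THEN conjunct2, THEN conjunct1])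
  show "\<exists>!(\<sigma>, s). (k - 1, \<sigma>) \<in> D \<and> reparam (k - 1) s (cube_face k i \<alpha> \<tau>) \<sigma>"
    if "i < k" "\<alpha> \<in> {-1, 1}"
    using cell that by (elim conjE) (drule spec, drule mp, assumption, erule bspec)
qed

text \<open>Unique existence in \<open>cell_complex\<close> makes the description in
  \<open>face_chain\<close> proper. The chain carries the coefficient \<open>s\<close>, and the
  integral over the face is \<open>s\<close> times that over the cell, so the two agree.\<close>

lemma chain_integral_face_chain:
  fixes M :: "('a, 'n::finite) manifold"
  assumes M: "oriented_manifold M" and a: "a \<in> forms M k" and D: "cell_complex M D"
    and cell: "(Suc k, \<tau>) \<in> D" and i: "i \<le> k" and \<alpha>: "\<alpha> \<in> {-1, 1}"
  shows "chain_integral M a (face_chain D (Suc k) i \<alpha> \<tau>) = cell_integral M a (k, cube_face (Suc k) i \<alpha> \<tau>)"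
proof -
  let ?P = "\<lambda>(\<sigma>, s). (k, \<sigma>) \<in> D \<and> reparam k s (cube_face (Suc k) i \<alpha> \<tau>) \<sigma>"
  have "\<exists>!x. ?P x"
    using cell_complexD(3)[OF D cell, of i \<alpha>] i \<alpha> by simp
  then have "?P (THE x. ?P x)" by (rule theI')
  then obtain \<sigma> s where \<sigma>: "(THE x. ?P x) = (\<sigma>, s)" "(k, \<sigma>) \<in> D" "reparam k s (cube_face (Suc k) i \<alpha> \<tau>) \<sigma>"
    by (cases "THE x. ?P x") auto
  have "k \<le> CARD('n)" "singular_cube M k \<sigma>"
    using cell_complexD(1,2)[OF D \<sigma>(2)] .
  from cell_integral_reparam[OF M a this(2,1) \<sigma>(3)]
  show ?thesis
    by (simp add: face_chain_def \<sigma>(1) chain_integral_cmul chain_integral_of)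
qed

theorem stokes_chain:
  fixes M :: "('a, 'n::finite) manifold"
  assumes M: "oriented_manifold M" and a: "a \<in> forms M k" and D: "cell_complex M D"
    and b: "b \<in> chains D (Suc k)"
  shows "chain_integral M (ext_deriv M k a) b = chain_integral M a (chain_bd D b)"
proof -
  let ?bd = "\<lambda>(k, \<tau>). \<Sum>i<k. frag_cmul ((-1) ^ i) (face_chain D k i 1 \<tau> - face_chain D k i (-1) \<tau>)"
  have cell: "chain_integral M a (?bd \<sigma>) = cell_integral M (ext_deriv M k a) \<sigma>"
    if key: "\<sigma> \<in> Poly_Mapping.keys b" for \<sigma>
  proof -
    obtain \<tau> where \<sigma>: "\<sigma> = (Suc k, \<tau>)" "(Suc k, \<tau>) \<in> D"
    proof -
      have "\<sigma> \<in> D" "fst \<sigma> = Suc k" using key b by (auto simp: chains_def)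
      then show ?thesis using that[of "snd \<sigma>"] by (cases \<sigma>) simp
    qed
    have "Suc k \<le> CARD('n)" "singular_cube M (Suc k) \<tau>"
      using cell_complexD(1,2)[OF D \<sigma>(2)] .
    note stokes = stokes_cube[OF M a this(2,1)]
    have "chain_integral M a (?bd \<sigma>) = (\<Sum>i\<le>k. (-1) ^ i * (cell_integral M a (k, cube_face (Suc k) i 1 \<tau>)
      - cell_integral M a (k, cube_face (Suc k) i (-1) \<tau>)))"
      by (simp add: \<sigma>(1) chain_integral_sum chain_integral_cmul chain_integral_diff lessThan_Suc_atMost
          chain_integral_face_chain[OF M a D \<sigma>(2)])
    then show ?thesis by (simp only: stokes \<sigma>(1))
  qed
  have "chain_integral M a (chain_bd D b)
      = (\<Sum>\<sigma>\<in>Poly_Mapping.keys b. of_int (Poly_Mapping.lookup b \<sigma>) * chain_integral M a (?bd \<sigma>))"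
    unfolding chain_bd_def frag_extend_def by (simp only: chain_integral_sum chain_integral_cmul)
  also have "\<dots> = chain_integral M (ext_deriv M k a) b"
    unfolding chain_integral_def[of _ "ext_deriv M k a"] by (intro sum.cong refl) (simp only: cell)
  finally show ?thesis ..
qed

text \<open>Stokes' theorem holds for all chains of \<open>D\<close>. Closure of \<open>E\<close>
  under the boundary ensures that the boundary of a chain of \<open>E\<close> is not cut off to the
  value 0 by the reduction on \<open>E\<close>.\<close>

lemma reduction_ext_deriv:
  assumes M: "oriented_manifold M" and a: "a \<in> forms M k" and D: "cell_complex M D"
    and E: "E \<subseteq> D" "bd_closed D E"
  shows "reduction M E (Suc k) (ext_deriv M k a) = coboundary D E k (reduction M E k a)"
proof
  fix b
  show "reduction M E (Suc k) (ext_deriv M k a) b = coboundary D E k (reduction M E k a) b"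
  proof (cases "b \<in> chains E (Suc k)")
    case True
    then have "chain_bd D b \<in> chains E k" using E(2) by (auto simp: bd_closed_def)
    moreover have "b \<in> chains D (Suc k)" using True E(1) by (auto simp: chains_def)
    ultimately show ?thesis
      using stokes_chain[OF M a D, of b] True
      by (simp add: reduction_def coboundary_def chain_integral_def)
  qed (simp add: reduction_def coboundary_def)
qed

text \<open>Makes the identities of \<open>reconstruction\<close>, which speak of cochains,
  applicable to reductions of forms.\<close>

lemma reduction_cochain: "reduction M E k a \<in> cochains E k"
proof -
  have "b + c \<in> chains E k" if "b \<in> chains E k" "c \<in> chains E k" for b c
    using that Poly_Mapping.keys_add[of b c] by (fastforce simp: chains_def)
  then show ?thesis
    using chain_integral_add[of M a]
    by (auto simp: cochains_def reduction_def chain_integral_def)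
qed

lemma projection_ext_deriv:
  fixes M :: "('a, 'n::finite) manifold"
  assumes "oriented_manifold M" "a \<in> forms M k" "cell_complex M D" "E \<subseteq> D" "bd_closed D E"
    and I: "reconstruction M D E I" and k: "k < CARD('n)"
  shows "ext_deriv M k (projection M E I k a) = projection M E I (Suc k) (ext_deriv M k a)"
proof -
  have "ext_deriv M k (I k (reduction M E k a)) = I (Suc k) (coboundary D E k (reduction M E k a))"
    using I[unfolded reconstruction_def, THEN conjunct2] k reduction_cochain by blast
  then show ?thesis
    using reduction_ext_deriv[OF assms(1-5)] by (simp add: projection_def)
qed

theorem lemma5:
  fixes M :: "('a, 'n::finite) manifold"
    and D D' D\<^sub>i D\<^sub>i' :: "'a cell set"
    and dual :: "'a cell \<Rightarrow> 'a cell"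
    and I I' :: "nat \<Rightarrow> ('a chain \<Rightarrow> real) \<Rightarrow> ('a, 'n) form"
    and k :: nat
  assumes "oriented_riemannian_manifold M"
    and "cell_complex M D"
    and "dual_complex M D D' dual"
    and "D\<^sub>i \<subseteq> D" and "D\<^sub>i' = dual ` D\<^sub>i"
    and "k < CARD('n)"
  shows "(bd_closed D D\<^sub>i \<and> reconstruction M D D\<^sub>i I \<longrightarrow>
            (\<forall>a\<in>forms M k. ext_deriv M k (projection M D\<^sub>i I k a)
                         = projection M D\<^sub>i I (Suc k) (ext_deriv M k a))) \<and>
         (bd_closed D' D\<^sub>i' \<and> reconstruction M D' D\<^sub>i' I' \<longrightarrow>
            (\<forall>a\<in>forms M k. ext_deriv M k (projection M D\<^sub>i' I' k a)
                         = projection M D\<^sub>i' I' (Suc k) (ext_deriv M k a)))"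
proof -
  have M: "oriented_manifold M"
    using assms(1) by (simp add: oriented_riemannian_manifold_def)
  have D': "cell_complex M D'" "dual ` D \<subseteq> D'"
    using assms(3) by (simp_all add: dual_complex_def)
  \<comment> \<open>With this inclusion the dual half is the same statement for the cell complex
    \<open>D'\<close> and its part \<open>dual\<close> applied to the cells of
    \<open>D\<^sub>i\<close>.\<close>
  then have "D\<^sub>i' \<subseteq> D'" using assms(4,5) by blast
  then show ?thesis
    using projection_ext_deriv[OF M _ assms(2,4) _ _ assms(6)]
      projection_ext_deriv[OF M _ D'(1) _ _ _ assms(6)] by blast
qed

end
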